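(* Let $q\ge 1$ and $0\le q'\le 1$. Consider the problem $$\min_{p(\mathbf{w}),\,\mathbf{z}}\; D_q(p(\mathbf{w})\|p_0(\mathbf{w}))+C\sum_{i=1}^{m}\exp_{q'}(-z_i)$$ $$\text{s.t.}\quad z_i=\int y_i\,\mathbf{f}_i^T\mathbf{w}\;p^q(\mathbf{w})\,d\mathbf{w}\quad(i=1,\dots,m),\qquad \int p(\mathbf{w})\,d\mathbf{w}=1 .$$ Then the solution (posterior distribution) $p(\mathbf{w})$ of this problem can be expressed in terms of the prior $p_0(\mathbf{w})$ and the vector $\boldsymbol{\beta}\in\mathbb{R}^m$ of Lagrange multipliers of the constraints on $z_1,\dots,z_m$ as $$p(\mathbf{w})=\frac{1}{Z_q(\boldsymbol{\beta})}\,p_0(\mathbf{w})\exp_q\!\left(p_0^{q-1}(\mathbf{w})\,\boldsymbol{\beta}^T\mathbf{H}\mathbf{w}\right),$$ where $Z_q(\boldsymbol{\beta})$ is the normalization factor (so that $\int p(\mathbf{w})\,d\mathbf{w}=1$) and $\mathbf{H}=(y_1\mathbf{f}_1,y_2\mathbf{f}_2,\dots,y_m\mathbf{f}_m)^T$. Moreover, the primal problem can be solved in the dual domain: its Lagrange dual problem is (up to sign and an additive constant in the objective) the problem $$\min_{\boldsymbol{\beta}}\;\ln_q\!\left(Z_q(\boldsymbol{\beta})\right)+C\,D_{1/q'}\!\left(\boldsymbol{\beta}/C\,\|\,\mathbf{1}_m\right)\qquad\text{s.t.}\quad\boldsymbol{\beta}\ge\mathbf{0}.$$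
   Context: Data: instance-label pairs $(\mathbf{x}_i,y_i)$, $i=1,\dots,m$, with $\mathbf{x}_i\in\mathbb{R}^n$, $y_i\in\{-1,+1\}$; fixed basis functions $\phi_1,\dots,\phi_d$ on $\mathbb{R}^n$; feature vectors $\mathbf{f}_i=(\phi_1(\mathbf{x}_i),\dots,\phi_d(\mathbf{x}_i))^T\in\mathbb{R}^d$. $C>0$ is a constant. The variable $\mathbf{w}\in\mathbb{R}^d$ is a continuous random vector with normalized probability density $p(\mathbf{w})$, and $p_0(\mathbf{w})$ is a given (prior) probability density on $\mathbb{R}^d$; $p^q(\mathbf{w})$ means $(p(\mathbf{w}))^q$. $\mathbf{z}=(z_1,\dots,z_m)^T\in\mathbb{R}^m$. $q$-exponential and $q$-logarithm: with $[x]_+=\max\{x,0\}$, $\exp_q x=[1+(1-q)x]_+^{\frac1{1-q}}$ and $\ln_q x=\frac{x^{1-q}-1}{1-q}$ for $q\ne1$; $\exp_1x=\exp x$, $\ln_1x=\ln x$. Tsallis divergence between normalized densities: $D_q(p(\mathbf{w})\|p_0(\mathbf{w}))=\frac{\int p^q(\mathbf{w})p_0^{1-q}(\mathbf{w})\,d\mathbf{w}-1}{q-1}$ for $q\neq1$, and $D_1(p(\mathbf{w})\|p_0(\mathbf{w}))=\int p(\mathbf{w})\ln\frac{p(\mathbf{w})}{p_0(\mathbf{w})}\,d\mathbf{w}$. Generalized Tsallis divergence between vectors $\mathbf{p},\mathbf{t}\in\mathbb{R}_+^m$ (nonnegative entries): $D_s(\mathbf{p}\|\mathbf{t})=\frac{\sum_{i=1}^m\left(p_i^s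 t_i^{1-s}-s\,p_i+(s-1)t_i\right)}{s-1}$ for $s\in\mathbb{R}\setminus\{1\}$, and $D_1(\mathbf{p}\|\mathbf{t})=\sum_{i=1}^m\left(p_i\ln\frac{p_i}{t_i}-p_i+t_i\right)$. $\mathbf{1}_m\in\mathbb{R}^m$ is the all-ones vector. For $q'=0$, $1/q'$ is read as $+\infty$, and $D_\infty(\mathbf{p}\|\mathbf{1}_m)=\lim_{s\to+\infty}D_s(\mathbf{p}\|\mathbf{1}_m)$, which equals $m-\sum_{i=1}^m p_i$ if $p_i\le 1$ for all $i$ and $+\infty$ otherwise.
   Formalization: For q>1 the formula for p(w) is claimed only when exp_q(p_0^{q-1} β^T H w) is finite a.e. (else Z_q is infinite and it fails), and the dual objective is taken as +∞ at β where 1+(1-q)p_0^{q-1} β^T H w is negative on a set of positive measure. *)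

theory Defs
  imports "HOL-Analysis.Analysis"
begin

definition q_exp :: "real \<Rightarrow> real \<Rightarrow> real" where
  "q_exp q x = (if q = 1 then exp x else (max 0 (1 + (1 - q) * x)) powr (1 / (1 - q)))"

definition q_ln :: "real \<Rightarrow> real \<Rightarrow> real" where
  "q_ln q x = (if q = 1 then ln x else (x powr (1 - q) - 1) / (1 - q))"

text \<open>
  For q > 1 the exponent 1 / (1 - q) is negative, so the q-exponential takes the value +infinity
  where the truncated base vanishes, whereas the library has 0 powr a = 0. Where q > 1 is possible
  the following extension is used, and the q-logarithm is extended to +infinity by continuity.
\<close>

definition q_exp_ext :: "real \<Rightarrow> real \<Rightarrow> ennreal" where
  "q_exp_ext q x = (if q > 1 \<and> 1 + (1 - q) * x \<le> 0 then \<infinity> else ennreal (q_exp q x))"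

definition q_ln_ext :: "real \<Rightarrow> ennreal \<Rightarrow> ereal" where
  "q_ln_ext q Z =
     (if Z < \<infinity> then ereal (q_ln q (enn2real Z))
      else if q > 1 then ereal (1 / (q - 1)) else \<infinity>)"

definition prob_density :: "('a::euclidean_space \<Rightarrow> real) \<Rightarrow> bool" where
  "prob_density p \<longleftrightarrow>
     p \<in> borel_measurable borel \<and> (\<forall>w. 0 \<le> p w) \<and> has_bochner_integral lborel p 1"

definition tsallis_div ::
  "real \<Rightarrow> ('a::euclidean_space \<Rightarrow> real) \<Rightarrow> ('a \<Rightarrow> real) \<Rightarrow> real" where
  "tsallis_div q p p0 =
     (if q = 1 then (LINT w|lborel. p w * ln (p w / p0 w))
      else ((LINT w|lborel. p w powr q * p0 w powr (1 - q)) - 1) / (q - 1))"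

text \<open>
  For q at least 1 the integrand of the divergence is +infinity at points with p0 = 0 < p (the
  library has 0 powr a = 0 and ln (a / 0) = 0 instead), so a finite divergence means absolute
  continuity together with integrability.
\<close>

definition tsallis_div_finite ::
  "real \<Rightarrow> ('a::euclidean_space \<Rightarrow> real) \<Rightarrow> ('a \<Rightarrow> real) \<Rightarrow> bool" where
  "tsallis_div_finite q p p0 \<longleftrightarrow>
     (AE w in lborel. p0 w = 0 \<longrightarrow> p w = 0) \<and>
     (if q = 1 then integrable lborel (\<lambda>w. p w * ln (p w / p0 w))
      else integrable lborel (\<lambda>w. p w powr q * p0 w powr (1 - q)))"

definition gen_tsallis_div :: "real \<Rightarrow> real ^ 'm::finite \<Rightarrow> real ^ 'm \<Rightarrow> real" where
  "gen_tsallis_div s p t =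
     (if s = 1 then (\<Sum>i\<in>UNIV. p $ i * ln (p $ i / t $ i) - p $ i + t $ i)
      else (\<Sum>i\<in>UNIV. (p $ i) powr s * (t $ i) powr (1 - s) - s * p $ i + (s - 1) * t $ i)
             / (s - 1))"

text \<open>The order s = +infinity is the limit of the finite orders; s = -infinity is not used.\<close>

definition gen_tsallis_div_ext :: "ereal \<Rightarrow> real ^ 'm::finite \<Rightarrow> real ^ 'm \<Rightarrow> ereal" where
  "gen_tsallis_div_ext s p t =
     (if s = \<infinity> then Lim at_top (\<lambda>r. ereal (gen_tsallis_div r p t))
      else ereal (gen_tsallis_div (real_of_ereal s) p t))"

definition feature_vec :: "('d::finite \<Rightarrow> real ^ 'n \<Rightarrow> real) \<Rightarrow> real ^ 'n \<Rightarrow> real ^ 'd" where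
  "feature_vec \<phi> x = (\<chi> j. \<phi> j x)"

definition label_feature_matrix ::
  "('m::finite \<Rightarrow> real) \<Rightarrow> ('m \<Rightarrow> real ^ 'd::finite) \<Rightarrow> real ^ 'd ^ 'm" where
  "label_feature_matrix y f = (\<chi> i. y i *\<^sub>R f i)"

definition q_margin ::
  "real \<Rightarrow> ('m::finite \<Rightarrow> real) \<Rightarrow> ('m \<Rightarrow> real ^ 'd::finite) \<Rightarrow> (real ^ 'd \<Rightarrow> real) \<Rightarrow> 'm \<Rightarrow> real" where
  "q_margin q y f p i = (LINT w|lborel. y i * (f i \<bullet> w) * p w powr q)"

text \<open>Normalized densities for which all integrals in the problem exist and are finite.\<close>

definition admissible_density ::
  "real \<Rightarrow> (real ^ 'd::finite \<Rightarrow> real) \<Rightarrow> ('m::finite \<Rightarrow> real) \<Rightarrow> ('m \<Rightarrow> real ^ 'd) \<Rightarrow>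
   (real ^ 'd \<Rightarrow> real) \<Rightarrow> bool" where
  "admissible_density q p0 y f p \<longleftrightarrow>
     prob_density p \<and> tsallis_div_finite q p p0 \<and>
     (\<forall>i. integrable lborel (\<lambda>w. y i * (f i \<bullet> w) * p w powr q))"

definition primal_feasible ::
  "real \<Rightarrow> (real ^ 'd::finite \<Rightarrow> real) \<Rightarrow> ('m::finite \<Rightarrow> real) \<Rightarrow> ('m \<Rightarrow> real ^ 'd) \<Rightarrow>
   (real ^ 'd \<Rightarrow> real) \<Rightarrow> real ^ 'm \<Rightarrow> bool" where
  "primal_feasible q p0 y f p z \<longleftrightarrow>
     admissible_density q p0 y f p \<and> (\<forall>i. z $ i = q_margin q y f p i)"

definition primal_objective ::
  "real \<Rightarrow> real \<Rightarrow> real \<Rightarrow> (real ^ 'd::finite \<Rightarrow> real) \<Rightarrow> (real ^ 'd \<Rightarrow> real) \<Rightarrow> real ^ 'm::finite \<Rightarrow> real" where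
  "primal_objective q q' C p0 p z = tsallis_div q p p0 + C * (\<Sum>i\<in>UNIV. q_exp q' (- z $ i))"

definition primal_solution ::
  "real \<Rightarrow> real \<Rightarrow> real \<Rightarrow> (real ^ 'd::finite \<Rightarrow> real) \<Rightarrow> ('m::finite \<Rightarrow> real) \<Rightarrow> ('m \<Rightarrow> real ^ 'd) \<Rightarrow>
   (real ^ 'd \<Rightarrow> real) \<Rightarrow> real ^ 'm \<Rightarrow> bool" where
  "primal_solution q q' C p0 y f p z \<longleftrightarrow>
     primal_feasible q p0 y f p z \<and>
     (\<forall>p' z'. primal_feasible q p0 y f p' z' \<longrightarrow>
        primal_objective q q' C p0 p z \<le> primal_objective q q' C p0 p' z')"

definition primal_value ::
  "real \<Rightarrow> real \<Rightarrow> real \<Rightarrow> (real ^ 'd::finite \<Rightarrow> real) \<Rightarrow> ('m::finite \<Rightarrow> real) \<Rightarrow> ('m \<Rightarrow> real ^ 'd) \<Rightarrow> ereal"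
  where
  "primal_value q q' C p0 y f =
     (INF (p, z) \<in> {(p, z). primal_feasible q p0 y f p z}.
        ereal (primal_objective q q' C p0 p z))"

text \<open>
  Only the constraints defining z carry multipliers; normalization of p is part of the domain.
\<close>

definition lagrangian ::
  "real \<Rightarrow> real \<Rightarrow> real \<Rightarrow> (real ^ 'd::finite \<Rightarrow> real) \<Rightarrow> ('m::finite \<Rightarrow> real) \<Rightarrow> ('m \<Rightarrow> real ^ 'd) \<Rightarrow>
   real ^ 'm \<Rightarrow> (real ^ 'd \<Rightarrow> real) \<Rightarrow> real ^ 'm \<Rightarrow> real" where
  "lagrangian q q' C p0 y f \<beta> p z =
     primal_objective q q' C p0 p z + (\<Sum>i\<in>UNIV. \<beta> $ i * (z $ i - q_margin q y f p i))"

definition lagrange_dual_function ::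
  "real \<Rightarrow> real \<Rightarrow> real \<Rightarrow> (real ^ 'd::finite \<Rightarrow> real) \<Rightarrow> ('m::finite \<Rightarrow> real) \<Rightarrow> ('m \<Rightarrow> real ^ 'd) \<Rightarrow>
   real ^ 'm \<Rightarrow> ereal" where
  "lagrange_dual_function q q' C p0 y f \<beta> =
     (INF (p, z) \<in> {p. admissible_density q p0 y f p} \<times> UNIV.
        ereal (lagrangian q q' C p0 y f \<beta> p z))"

definition lagrange_multiplier ::
  "real \<Rightarrow> real \<Rightarrow> real \<Rightarrow> (real ^ 'd::finite \<Rightarrow> real) \<Rightarrow> ('m::finite \<Rightarrow> real) \<Rightarrow> ('m \<Rightarrow> real ^ 'd) \<Rightarrow>
   (real ^ 'd \<Rightarrow> real) \<Rightarrow> real ^ 'm \<Rightarrow> real ^ 'm \<Rightarrow> bool" where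
  "lagrange_multiplier q q' C p0 y f p z \<beta> \<longleftrightarrow>
     (\<forall>p' z'. admissible_density q p0 y f p' \<longrightarrow>
        lagrangian q q' C p0 y f \<beta> p z \<le> lagrangian q q' C p0 y f \<beta> p' z')"

definition q_exponent ::
  "real \<Rightarrow> (real ^ 'd::finite \<Rightarrow> real) \<Rightarrow> real ^ 'd ^ 'm::finite \<Rightarrow> real ^ 'm \<Rightarrow> real ^ 'd \<Rightarrow> real" where
  "q_exponent q p0 H \<beta> w = p0 w powr (q - 1) * (\<beta> \<bullet> (H *v w))"

definition q_normalizer ::
  "real \<Rightarrow> (real ^ 'd::finite \<Rightarrow> real) \<Rightarrow> real ^ 'd ^ 'm::finite \<Rightarrow> real ^ 'm \<Rightarrow> ennreal" where
  "q_normalizer q p0 H \<beta> =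
     (\<integral>\<^sup>+ w. ennreal (p0 w) * q_exp_ext q (q_exponent q p0 H \<beta> w) \<partial>lborel)"

text \<open>
  For q > 1 a multiplier vector that makes 1 + (1 - q) * q_exponent negative on a set of positive
  measure lies outside the effective domain: the q-exponential is applied there beyond its pole,
  and the Lagrangian is unbounded below in p. The objective is +infinity at such a vector. For q = 1
  the condition holds trivially.
\<close>

definition dual_objective ::
  "real \<Rightarrow> real \<Rightarrow> real \<Rightarrow> (real ^ 'd::finite \<Rightarrow> real) \<Rightarrow> real ^ 'd ^ 'm::finite \<Rightarrow> real ^ 'm \<Rightarrow> ereal" where
  "dual_objective q q' C p0 H \<beta> =
     (if AE w in lborel. 0 \<le> 1 + (1 - q) * q_exponent q p0 H \<beta> w
      then q_ln_ext q (q_normalizer q p0 H \<beta>)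
             + ereal C * gen_tsallis_div_ext (1 / ereal q') ((1 / C) *\<^sub>R \<beta>) (\<chi> i. 1)
      else \<infinity>)"

definition dual_solution ::
  "real \<Rightarrow> real \<Rightarrow> real \<Rightarrow> (real ^ 'd::finite \<Rightarrow> real) \<Rightarrow> real ^ 'd ^ 'm::finite \<Rightarrow> real ^ 'm \<Rightarrow> bool" where
  "dual_solution q q' C p0 H \<beta> \<longleftrightarrow>
     (\<forall>i. 0 \<le> \<beta> $ i) \<and>
     (\<forall>\<beta>'. (\<forall>i. 0 \<le> \<beta>' $ i) \<longrightarrow> dual_objective q q' C p0 H \<beta> \<le> dual_objective q q' C p0 H \<beta>')"

end

theory Submission
  imports Defs
begin

text \<open>
  Write \<open>\<rho> = p0 * exp_q (p0 ^ (q - 1) * \<beta> \<bullet> H w)\<close>. For a density \<open>p\<close> the Tsallis divergence from the prior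
  minus \<open>\<beta>\<close> times the margins is the integral of \<open>- p * ln_q (\<rho> / p)\<close>, so \<open>ln_q u \<le> u - 1\<close> bounds it
  below by \<open>- ln_q Z\<close>, with equality only for \<open>p = \<rho> / Z\<close>; truncations of \<open>\<rho>\<close> show that the bound is
  sharp. The minimum over \<open>z\<close> is a Fenchel conjugate, evaluated with Young's inequality.

  The margin constraints are not affine in \<open>p\<close> when \<open>q > 1\<close>. Nevertheless the set of attainable pairs of
  divergence and margins has convex closure, because Lebesgue measure has no atoms: one may switch
  between two densities on a set that splits all integrals in a prescribed ratio. A hyperplane
  separating this closure from a strict sublevel region of the loss yields the multipliers and strong
  duality.
\<close>

section \<open>The deformed logarithm and exponential\<close>

text \<open>The margins weigh a density by its \<open>q\<close>-th power, and this dictates the form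
  of the solution: a term linear in \<open>a powr q\<close> can be absorbed into the reference value
  \<open>b\<close> of \<open>tsallis_integrand q a b\<close>, but only after multiplication by
  \<open>b powr (q - 1)\<close>; hence the prior inside the q-exponential. The separating hyperplane
  is never vertical, because the loss is finite everywhere. For \<open>q > 1\<close> the pole of the
  q-exponential creates three regimes, told apart by the sign of \<open>base \<beta>\<close>. If it
  is positive almost everywhere, the tilted prior is finite, though perhaps not normalizable. If it
  is nonnegative but vanishes on a set of positive measure, densities concentrated there reach
  \<open>- (1 / (q - 1))\<close>. If it is negative on such a set, concentration on ever smaller
  subsets drives the Lagrangian to minus infinity. The conventions in \<open>q_ln_ext\<close> and
  \<open>dual_objective\<close> are exactly these values.\<close>

lemma q_ln_1 [simp]: "q_ln q 1 = 0"
  by (simp add: q_ln_def)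

text \<open>The deformed substitute for additivity. Its asymmetric factor
  \<open>u powr (1 - q)\<close> turns scaling and tilting of a density into explicit correction
  terms.\<close>

lemma q_ln_mult:
  assumes "u > 0" "v > 0"
  shows "q_ln q (u * v) = q_ln q u + u powr (1 - q) * q_ln q v"
  using assms by (simp add: q_ln_def ln_mult powr_mult add_divide_distrib[symmetric] algebra_simps)

lemma q_exp_pos:
  assumes "0 < 1 + (1 - q) * x"
  shows "0 < q_exp q x"
  using assms by (simp add: q_exp_def)

lemma q_ln_q_exp:
  assumes "0 < 1 + (1 - q) * x"
  shows "q_ln q (q_exp q x) = x"
  using assms by (simp add: q_ln_def q_exp_def powr_powr)

text \<open>For \<open>q \<ge> 1\<close> the deformed logarithm lies below \<open>ln\<close>: apply
  \<open>ln v \<le> v - 1\<close> at \<open>v = u powr (1 - q)\<close> and divide by the negative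
  number \<open>1 - q\<close>.\<close>

lemma q_ln_le_minus_one:
  assumes "q \<ge> 1" "u > 0"
  shows "q_ln q u \<le> u - 1"
proof (cases "q = 1")
  case False
  have "(1 - q) * ln u \<le> u powr (1 - q) - 1"
    using ln_le_minus_one[of "u powr (1 - q)"] assms by simp
  hence "q_ln q u \<le> ln u"
    using assms False by (simp add: q_ln_def divide_simps mult.commute)
  thus ?thesis
    using ln_le_minus_one[of u] assms by simp
qed (use assms ln_le_minus_one in \<open>auto simp: q_ln_def\<close>)

lemma q_ln_eq_minus_one:
  assumes "q \<ge> 1" "u > 0" "q_ln q u = u - 1"
  shows "u = 1"
proof -
  have "q_ln q u \<le> ln u"
  proof (cases "q = 1")
    case False
    have "(1 - q) * ln u \<le> u powr (1 - q) - 1"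
      using ln_le_minus_one[of "u powr (1 - q)"] assms by simp
    thus ?thesis
      using assms False by (simp add: q_ln_def divide_simps mult.commute)
  qed (simp add: q_ln_def)
  thus ?thesis
    using ln_eq_minus_one[of u] ln_le_minus_one[of u] assms by simp
qed

lemma tendsto_q_ln:
  assumes "(f \<longlongrightarrow> l) F" "l > 0"
  shows "((\<lambda>n. q_ln q (f n)) \<longlongrightarrow> q_ln q l) F"
  using assms unfolding q_ln_def
  by (cases "q = 1") (auto intro!: tendsto_intros)

text \<open>For \<open>q > 1\<close> the deformed logarithm is bounded above; its limit is the value
  that \<open>q_ln_ext\<close> assigns to an infinite normalizer.\<close>

lemma q_ln_at_top_gt_one:
  assumes "q > 1" "filterlim f at_top F"
  shows "((\<lambda>n. q_ln q (f n)) \<longlongrightarrow> 1 / (q - 1)) F"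
proof -
  have "((\<lambda>n. f n powr (1 - q)) \<longlongrightarrow> 0) F"
    using assms by (intro tendsto_neg_powr) auto
  hence "((\<lambda>n. (f n powr (1 - q) - 1) / (1 - q)) \<longlongrightarrow> (0 - 1) / (1 - q)) F"
    by (intro tendsto_intros) (use assms in auto)
  moreover have "(0 - 1) / (1 - q) = 1 / (q - 1)"
    using assms by (simp add: divide_simps)
  ultimately show ?thesis
    using assms by (simp add: q_ln_def)
qed

text \<open>Convexity of \<open>powr\<close> on the open half-line extends to the endpoint 0 because
  \<open>c powr P \<le> c\<close> on the unit interval; composing the monotone power with the convex
  truncation \<open>max 0\<close> preserves it.\<close>

lemma max_powr_convex:
  fixes P :: real
  assumes "P \<ge> 1"
  shows "convex_on UNIV (\<lambda>x::real. max 0 x powr P)"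
proof -
  have nonneg: "(t * x + s * y) powr P \<le> t * x powr P + s * y powr P"
    if "x \<ge> 0" "y \<ge> 0" "t \<ge> 0" "s \<ge> 0" "t + s = 1" for x y t s :: real
  proof -
    have scale: "(c * v) powr P \<le> c * v powr P" if "0 \<le> c" "c \<le> 1" "0 \<le> v" for c v
    proof -
      have "c powr P \<le> c powr 1"
        using powr_mono'[of 1 P c] that assms by simp
      thus ?thesis
        using that by (simp add: powr_mult mult_right_mono)
    qed
    show ?thesis
    proof (cases "x = 0 \<or> y = 0")
      case True
      thus ?thesis
        using scale[of t x] scale[of s y] that by auto
    next
      case False
      hence "x > 0" "y > 0" using that by auto
      moreover have "\<forall>x\<in>{0<..}. \<forall>y\<in>{0<..}. \<forall>u\<ge>0. \<forall>v\<ge>0. u + v = 1 \<longrightarrow>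
          (u * x + v * y) powr P \<le> u * x powr P + v * y powr P"
        using powr_convex[OF assms] by (simp add: convex_on_def)
      ultimately show ?thesis
        using that by blast
    qed
  qed
  show ?thesis
  proof (rule convex_onI)
    fix t x y :: real
    assume t: "0 < t" "t < 1"
    have "max 0 ((1 - t) * x + t * y) \<le> (1 - t) * max 0 x + t * max 0 y"
      using t by (auto simp: max_def add_nonneg_nonneg mult_nonneg_nonneg mult_le_0_iff add_nonpos_nonpos
          intro!: add_mono mult_left_mono)
    hence "max 0 ((1 - t) * x + t * y) powr P \<le> ((1 - t) * max 0 x + t * max 0 y) powr P"
      using assms by (intro powr_mono2) auto
    also have "\<dots> \<le> (1 - t) * max 0 x powr P + t * max 0 y powr P"
      using t by (intro nonneg) auto
    finally show "max 0 ((1 - t) *\<^sub>R x + t *\<^sub>R y) powr P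
        \<le> (1 - t) * max 0 x powr P + t * max 0 y powr P"
      by simp
  qed simp
qed

lemma q_exp_nonneg: "0 \<le> q_exp q x"
  by (simp add: q_exp_def)

lemma convex_on_q_exp:
  assumes "0 \<le> q'" "q' \<le> 1"
  shows "convex_on UNIV (q_exp q')"
proof (cases "q' = 1")
  case True
  have "convex_on UNIV (exp :: real \<Rightarrow> real)"
    by (rule exp_convex)
  thus ?thesis
    using True by (simp add: q_exp_def[abs_def])
next
  case False
  define P where "P = 1 / (1 - q')"
  have P: "P \<ge> 1"
    using assms False by (simp add: P_def)
  show ?thesis
  proof (rule convex_onI)
    fix t x y :: real
    assume t: "0 < t" "t < 1"
    have "1 + (1 - q') * ((1 - t) * x + t * y)
        = (1 - t) * (1 + (1 - q') * x) + t * (1 + (1 - q') * y)"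
      by (simp add: algebra_simps)
    thus "q_exp q' ((1 - t) *\<^sub>R x + t *\<^sub>R y) \<le> (1 - t) * q_exp q' x + t * q_exp q' y"
      using convex_onD[OF max_powr_convex[OF P], of t "1 + (1 - q') * x" "1 + (1 - q') * y"] t False
      by (simp add: q_exp_def P_def)
  qed simp
qed

lemma continuous_on_q_exp:
  assumes "0 \<le> q'" "q' \<le> 1"
  shows "continuous_on S (q_exp q')"
proof (cases "q' = 1")
  case True
  thus ?thesis
    by (auto simp: q_exp_def[abs_def] intro!: continuous_intros)
next
  case False
  hence "q' < 1" using assms by simp
  hence "continuous_on S (\<lambda>x. max 0 (1 + (1 - q') * x) powr (1 / (1 - q')))"
    by (intro continuous_on_powr' continuous_on_max continuous_on_add continuous_on_mult
          continuous_on_const continuous_on_id) auto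
  thus ?thesis
    using False by (simp add: q_exp_def[abs_def])
qed

text \<open>The loss stays below \<open>C\<close> for \<open>z \<ge> 0\<close>, so a negative slope
  wins. This is the origin of the constraint \<open>\<beta> \<ge> 0\<close> in the dual.\<close>

lemma q_exp_linear_unbounded:
  assumes "0 \<le> q'" "q' \<le> 1" "C > 0" "b < 0"
  shows "\<exists>z. C * q_exp q' (- z) + b * z < c"
proof -
  define z where "z = max 0 ((C - c + 1) / (- b))"
  have z: "z \<ge> 0" "(C - c + 1) / (- b) \<le> z"
    by (auto simp: z_def)
  have "C - c + 1 \<le> z * (- b)"
    using z(2) assms(4) by (subst (asm) pos_divide_le_eq) auto
  moreover have "q_exp q' (- z) \<le> 1"
  proof (cases "q' = 1")
    case False
    have "max 0 (1 + (1 - q') * (- z)) powr (1 / (1 - q')) \<le> 1 powr (1 / (1 - q'))"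
      using z assms by (intro powr_mono2) (auto simp: mult_nonneg_nonneg)
    thus ?thesis
      using False by (simp add: q_exp_def)
  qed (use z in \<open>simp add: q_exp_def\<close>)
  hence "C * q_exp q' (- z) \<le> C"
    using assms by (simp add: mult_left_le)
  ultimately have "C * q_exp q' (- z) + b * z < c"
    by (simp add: algebra_simps)
  thus ?thesis ..
qed

text \<open>One summand of the divergence from the all-ones vector. With \<open>s = 1 / q'\<close>,
  \<open>0 < q' \<le> 1\<close> and \<open>b \<ge> 0\<close>, the number
  \<open>1 - tsallis_term s b\<close> is the infimum over \<open>z\<close> of
  \<open>q_exp q' (- z) + b * z\<close>, that is, a Fenchel conjugate of the loss up to
  sign.\<close>

definition tsallis_term :: "real \<Rightarrow> real \<Rightarrow> real" where
  "tsallis_term s b = (if s = 1 then b * ln b - b + 1 else (b powr s - s * b + (s - 1)) / (s - 1))"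

lemma gen_tsallis_div_ones:
  "gen_tsallis_div s p (\<chi> i. 1) = (\<Sum>i\<in>UNIV. tsallis_term s (p $ i))"
  by (simp add: gen_tsallis_div_def tsallis_term_def sum_divide_distrib)

lemma tsallis_term_reciprocal:
  assumes "0 < q'" "q' < 1"
  shows "(1 - q') * (1 - tsallis_term (1 / q') b) = b - q' * b powr (1 / q')"
proof -
  have "tsallis_term (1 / q') b = (q' * b powr (1 / q') - b + (1 - q')) / (1 - q')"
    using assms by (simp add: tsallis_term_def divide_simps algebra_simps)
  hence "(1 - q') * tsallis_term (1 / q') b = q' * b powr (1 / q') - b + (1 - q')"
    using assms by simp
  thus ?thesis
    by (simp add: right_diff_distrib)
qed

text \<open>For \<open>q' < 1\<close> this is Young's inequality with the conjugate exponents
  \<open>1 / (1 - q')\<close> and \<open>1 / q'\<close>, applied to the truncated base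
  \<open>u\<close> and to \<open>b\<close>.\<close>

lemma q_exp_linear_lower:
  assumes "0 < q'" "q' \<le> 1" "b \<ge> 0"
  shows "1 - tsallis_term (1 / q') b \<le> q_exp q' (- z) + b * z"
proof (cases "q' = 1")
  case True
  show ?thesis
  proof (cases "b = 0")
    case False
    hence b: "b > 0" using assms by simp
    \<comment> \<open>The tangent bound for \<open>exp\<close> at 0; its argument vanishes at the
      minimizer \<open>z = - ln b\<close>.\<close>
    have "b * (1 + (- z - ln b)) \<le> b * exp (- z - ln b)"
      using b by (intro mult_left_mono exp_ge_add_one_self) auto
    also have "\<dots> = exp (- z)"
      using b by (simp add: exp_diff)
    finally show ?thesis
      using True by (simp add: tsallis_term_def q_exp_def algebra_simps)
  qed (simp add: True tsallis_term_def q_exp_def)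
next
  case False
  hence q': "q' < 1" using assms by simp
  define u where "u = max 0 (1 + (1 - q') * (- z))"
  have u: "u \<ge> 0" "q_exp q' (- z) = u powr (1 / (1 - q'))"
    using False by (auto simp: u_def q_exp_def)
  have "u * b \<le> u powr (1 / (1 - q')) / (1 / (1 - q')) + b powr (1 / q') / (1 / q')"
    using assms False u by (intro Youngs_inequality) (auto simp: field_simps)
  hence Y: "u * b \<le> (1 - q') * u powr (1 / (1 - q')) + q' * b powr (1 / q')"
    by (simp add: mult.commute)
  have "1 - u \<le> (1 - q') * z"
    by (simp add: u_def)
  hence "b * (1 - u) \<le> b * ((1 - q') * z)"
    using assms by (intro mult_left_mono) auto
  hence "(1 - q') * (1 - tsallis_term (1 / q') b) \<le> (1 - q') * (q_exp q' (- z) + b * z)"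
    unfolding tsallis_term_reciprocal[OF assms(1) q'] u(2)
    using Y by (simp add: algebra_simps)
  thus ?thesis
    using assms False by simp
qed

text \<open>The point \<open>z\<close> is read off from the equality case of Young's inequality.
  Some slack \<open>e\<close> is unavoidable: for \<open>q' = 1\<close> and \<open>b = 0\<close> the
  infimum 0 of \<open>exp (- z)\<close> is not attained.\<close>

lemma q_exp_linear_approx:
  assumes "0 < q'" "q' \<le> 1" "b \<ge> 0" "e > 0"
  shows "\<exists>z. q_exp q' (- z) + b * z < 1 - tsallis_term (1 / q') b + e"
proof (cases "q' = 1")
  case True
  show ?thesis
  proof (cases "b = 0")
    case False
    thus ?thesis
      using assms True by (intro exI[of _ "- ln b"]) (auto simp: q_exp_def tsallis_term_def)
  next
    case b: True
    thus ?thesis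
      using assms True by (intro exI[of _ "- ln (e / 2)"]) (auto simp: q_exp_def tsallis_term_def)
  qed
next
  case False
  hence q': "q' < 1" using assms by simp
  define u where "u = b powr ((1 - q') / q')"
  define z where "z = (1 - u) / (1 - q')"
  have "max 0 (1 + (1 - q') * (- z)) = u"
    using False by (simp add: z_def u_def)
  hence 1: "q_exp q' (- z) = b powr (1 / q')"
    using False assms by (simp add: q_exp_def u_def powr_powr)
  have 2: "u * b = b powr (1 / q')"
  proof (cases "b = 0")
    case False
    hence "u * b = b powr ((1 - q') / q' + 1)"
      using assms by (simp add: u_def powr_add)
    thus ?thesis
      using assms by (simp add: diff_divide_distrib)
  qed (use assms in auto)
  have "(1 - q') * (b * z) = b * (1 - u)"
    using False by (simp add: z_def)
  hence "(1 - q') * (q_exp q' (- z) + b * z) = (1 - q') * (1 - tsallis_term (1 / q') b)"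
    unfolding tsallis_term_reciprocal[OF assms(1) q'] 1 distrib_left
    using 2 by (simp add: algebra_simps)
  thus ?thesis
    using False assms by (intro exI[of _ z]) simp
qed

text \<open>For \<open>q' = 0\<close> the loss is the hinge \<open>max 0 (1 - z)\<close>. With a
  linear term added it is bounded below only for slopes in the unit interval, and the minimum
  \<open>b\<close> then sits at \<open>z = 1\<close>.\<close>

lemma hinge_linear_lower:
  assumes "0 \<le> b" "b \<le> 1"
  shows "b \<le> q_exp 0 (- z) + b * z"
proof -
  have "b * (1 - z) \<le> 1 * max 0 (1 - z)"
    using assms by (cases "z \<le> 1") (auto simp: mult_left_le_one_le mult_nonneg_nonpos)
  thus ?thesis
    by (simp add: q_exp_def algebra_simps)
qed

lemma hinge_linear_unbounded:
  assumes "b > 1"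
  shows "\<exists>z. q_exp 0 (- z) + b * z < c"
proof -
  define z where "z = min 0 ((c - 2) / (b - 1))"
  have "z \<le> (c - 2) / (b - 1)" "z \<le> 0"
    by (auto simp: z_def)
  hence "z * (b - 1) \<le> c - 2" "z \<le> 0"
    using assms by (auto simp: pos_le_divide_eq)
  thus ?thesis
    by (intro exI[of _ z]) (simp add: q_exp_def algebra_simps)
qed

section \<open>Splitting integrals in a given ratio\<close>

text \<open>The mass of \<open>B\<close> inside a ball depends continuously on the radius, because
  it changes by at most the volume of a shell; the intermediate value theorem then supplies the
  radius.\<close>

lemma lborel_split_set:
  fixes B :: "'a::euclidean_space set"
  assumes [measurable]: "B \<in> sets borel" and fin: "emeasure lborel B < \<infinity>"
    and t: "0 \<le> t" "t \<le> 1"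
  shows "\<exists>A\<in>sets borel. A \<subseteq> B \<and> measure lborel A = t * measure lborel B"
\<comment> \<open>The target must lie strictly below the mass of \<open>B\<close>, so that some ball
  of finite radius overshoots it.\<close>
proof (cases "t = 1 \<or> measure lborel B = 0")
  case True
  show ?thesis
  proof (cases "t = 1")
    case False
    thus ?thesis using True by (intro bexI[of _ "{}"]) auto
  qed (auto intro!: bexI[of _ B])
next
  case False
  define \<mu> where "\<mu> r = measure lborel (B \<inter> cball 0 r)" for r
  define V where "V r = unit_ball_vol (DIM('a)) * r ^ DIM('a)" for r :: real
  have B: "B \<in> fmeasurable lborel"
    using fin by (intro fmeasurableI) auto
  have ball: "(cball 0 r :: 'a set) \<in> fmeasurable lborel" for r
    by (rule fmeasurableI) (use emeasure_bounded_finite[OF bounded_cball[of "0::'a" r]] in simp_all)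
  have mono: "\<bar>\<mu> s - \<mu> r\<bar> \<le> \<bar>V s - V r\<bar>" if "0 \<le> r" "r \<le> s" for r s
  proof -
    have sub: "(cball 0 r :: 'a set) \<subseteq> cball 0 s"
      using that by (auto simp: subset_cball)
    have "\<mu> s - \<mu> r = measure lborel (B \<inter> cball 0 s - B \<inter> cball 0 r)"
      unfolding \<mu>_def using sub B ball
      by (intro measurable_measure_Diff[symmetric]) (auto intro!: fmeasurable.Int)
    moreover have "measure lborel (B \<inter> cball 0 s - B \<inter> cball 0 r)
        \<le> measure lborel (cball 0 s - cball 0 r :: 'a set)"
      using ball by (intro measure_mono_fmeasurable) (auto intro!: fmeasurable.Diff)
    moreover have "measure lborel (cball 0 s - cball 0 r :: 'a set) = V s - V r"
      using sub ball that
      by (subst measurable_measure_Diff) (auto simp: V_def content_cball)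
    ultimately show ?thesis
      by (smt (verit) measure_nonneg)
  qed
  have bound: "\<bar>\<mu> s - \<mu> r\<bar> \<le> \<bar>V s - V r\<bar>" if "0 \<le> r" "0 \<le> s" for r s
    using mono[of r s] mono[of s r] that by (cases "r \<le> s") auto
  have cont: "continuous_on {0..b} \<mu>" for b
  proof (unfold continuous_on_def, intro ballI)
    fix r assume r: "r \<in> {0..b}"
    have "continuous_on {0..b} V"
      unfolding V_def by (intro continuous_intros)
    hence "(V \<longlongrightarrow> V r) (at r within {0..b})"
      using r by (simp add: continuous_on_def)
    hence "((\<lambda>s. \<bar>V s - V r\<bar>) \<longlongrightarrow> \<bar>V r - V r\<bar>) (at r within {0..b})"
      by (intro tendsto_intros)
    hence "((\<lambda>s. \<bar>V s - V r\<bar>) \<longlongrightarrow> 0) (at r within {0..b})"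
      by simp
    hence "((\<lambda>s. \<mu> s - \<mu> r) \<longlongrightarrow> 0) (at r within {0..b})"
      by (rule Lim_null_comparison[rotated])
        (use r in \<open>auto simp: eventually_at_filter intro!: bound always_eventually\<close>)
    thus "(\<mu> \<longlongrightarrow> \<mu> r) (at r within {0..b})"
      by (rule LIM_zero_cancel)
  qed
  have "(\<lambda>n. measure lborel (B \<inter> cball 0 (real n))) \<longlonglongrightarrow> measure lborel (\<Union>n. B \<inter> cball 0 (real n))"
  proof (rule Lim_measure_incseq)
    show "emeasure lborel (\<Union>n. B \<inter> cball 0 (real n)) \<noteq> \<infinity>"
      using order.strict_trans1[OF emeasure_mono[of "\<Union>n. B \<inter> cball 0 (real n)" B lborel] fin]
      by auto
  qed (auto simp: incseq_def)
  moreover have "(\<Union>n. B \<inter> cball 0 (real n)) = B"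
    by (auto simp: real_arch_simple)
  ultimately have "(\<lambda>n. \<mu> (real n)) \<longlonglongrightarrow> measure lborel B"
    by (simp add: \<mu>_def)
  moreover have "t * measure lborel B < measure lborel B"
    using False t by (simp add: zero_less_measure_iff)
  ultimately have "\<forall>\<^sub>F n in sequentially. t * measure lborel B < \<mu> (real n)"
    by (rule order_tendstoD)
  then obtain n where n: "t * measure lborel B < \<mu> (real n)"
    by (auto simp: eventually_sequentially)
  have "\<mu> 0 \<le> measure lborel ({0} :: 'a set)"
    unfolding \<mu>_def by (intro measure_mono_fmeasurable) (auto intro!: fmeasurableI)
  hence "\<mu> 0 \<le> 0"
    by (simp add: measure_def)
  moreover have "0 \<le> t * measure lborel B"
    using t by simp
  ultimately have "\<mu> 0 \<le> t * measure lborel B"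
    by linarith
  then obtain r where "\<mu> r = t * measure lborel B"
    using IVT'[of \<mu> 0 "t * measure lborel B" "real n"] n cont by auto
  thus ?thesis
    by (intro bexI[of _ "B \<inter> cball 0 r"]) (auto simp: \<mu>_def)
qed

text \<open>On each level set the function is a constant vector, so splitting the measure of the
  level set splits all coordinates of the integral at once. Only nonzero values are treated: their
  level sets have finite measure.\<close>

lemma simple_split_set:
  fixes s :: "'a::euclidean_space \<Rightarrow> 'b::euclidean_space"
  assumes s: "Bochner_Integration.simple_bochner_integrable lborel s" and t: "0 \<le> t" "t \<le> 1"
  shows "\<exists>A\<in>sets borel. (LINT w|lborel. indicator A w *\<^sub>R s w) = t *\<^sub>R (LINT w|lborel. s w)"
proof -
  define I where "I = range s - {0}"
  have sf: "simple_function lborel s" and fin0: "emeasure lborel {w. s w \<noteq> 0} < \<infinity>"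
    using s by (auto simp: simple_bochner_integrable.simps less_top)
  have I: "finite I"
    using simple_functionD(1)[OF sf] by (simp add: I_def)
  have meas: "s -` {v} \<in> sets borel" for v
    using simple_functionD(2)[OF sf, of "{v}"] by simp
  have fin: "emeasure lborel (s -` {v}) < \<infinity>" if "v \<in> I" for v
  proof -
    have "emeasure lborel (s -` {v}) \<le> emeasure lborel {w. s w \<noteq> 0}"
    proof (rule emeasure_mono)
      show "{w. s w \<noteq> 0} \<in> sets lborel"
        using borel_measurable_simple_function[OF sf] by measurable
    qed (use that in \<open>auto simp: I_def\<close>)
    thus ?thesis using fin0 by simp
  qed
  have "\<forall>v\<in>I. \<exists>A\<in>sets borel. A \<subseteq> s -` {v} \<and> measure lborel A = t * measure lborel (s -` {v})"
    using lborel_split_set[OF meas fin t] by blast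
  then obtain A where A: "\<And>v. v \<in> I \<Longrightarrow> A v \<in> sets borel" "\<And>v. v \<in> I \<Longrightarrow> A v \<subseteq> s -` {v}"
      "\<And>v. v \<in> I \<Longrightarrow> measure lborel (A v) = t * measure lborel (s -` {v})"
    by metis
  have split: "indicator (\<Union>v\<in>I. A v \<inter> D) w *\<^sub>R s w = (\<Sum>v\<in>I. indicator (A v \<inter> D) w *\<^sub>R v)" for w D
  proof (cases "s w \<in> I")
    case True
    have "(\<Sum>v\<in>I. indicator (A v \<inter> D) w *\<^sub>R v) = (\<Sum>v\<in>I. if v = s w then indicator (A v \<inter> D) w *\<^sub>R v else 0)"
      using A(2) by (intro sum.cong refl) (auto simp: indicator_def)
    also have "\<dots> = indicator (A (s w) \<inter> D) w *\<^sub>R s w"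
      using True I by (simp add: sum.delta')
    also have "indicator (A (s w) \<inter> D) w = (indicator (\<Union>v\<in>I. A v \<inter> D) w :: real)"
      using A(2) True by (auto simp: indicator_def)
    finally show ?thesis by simp
  next
    case False
    hence "s w = 0" by (auto simp: I_def)
    moreover have "(\<Sum>v\<in>I. indicator (A v \<inter> D) w *\<^sub>R v) = 0"
      using False A(2) by (intro sum.neutral ballI) (auto simp: indicator_def)
    ultimately show ?thesis by simp
  qed
  have full: "s w = (\<Sum>v\<in>I. indicator (s -` {v}) w *\<^sub>R v)" for w
  proof (cases "s w \<in> I")
    case True
    have "(\<Sum>v\<in>I. indicator (s -` {v}) w *\<^sub>R v) = (\<Sum>v\<in>I. if v = s w then v else 0)"
      by (intro sum.cong refl) (auto simp: indicator_def)
    thus ?thesis using True I by simp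
  next
    case False
    hence "s w = 0" by (auto simp: I_def)
    moreover have "(\<Sum>v\<in>I. indicator (s -` {v}) w *\<^sub>R v) = 0"
      using False by (intro sum.neutral ballI) (auto simp: indicator_def)
    ultimately show ?thesis by simp
  qed
  have finA: "emeasure lborel (A v) < \<infinity>" if "v \<in> I" for v
    using emeasure_mono[OF A(2)[OF that], of lborel] fin[OF that] meas by auto
  let ?A = "\<Union>v\<in>I. A v"
  have "(LINT w|lborel. indicator ?A w *\<^sub>R s w) = (LINT w|lborel. (\<Sum>v\<in>I. indicator (A v) w *\<^sub>R v))"
    by (rule Bochner_Integration.integral_cong) (use split[of UNIV] in auto)
  also have "\<dots> = (\<Sum>v\<in>I. measure lborel (A v) *\<^sub>R v)"
    using A(1) finA by (subst Bochner_Integration.integral_sum) auto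
  also have "\<dots> = t *\<^sub>R (\<Sum>v\<in>I. measure lborel (s -` {v}) *\<^sub>R v)"
    by (simp add: A(3) scaleR_sum_right)
  also have "(\<Sum>v\<in>I. measure lborel (s -` {v}) *\<^sub>R v)
      = (LINT w|lborel. (\<Sum>v\<in>I. indicator (s -` {v}) w *\<^sub>R v))"
    using meas fin by (subst Bochner_Integration.integral_sum) auto
  also have "\<dots> = (LINT w|lborel. s w)"
    by (rule Bochner_Integration.integral_cong) (auto simp only: full[symmetric])
  finally show ?thesis
    using A(1) I by (intro bexI[of _ ?A]) auto
qed

text \<open>An approximate form of Lyapunov's convexity theorem.\<close>

lemma approximate_split_set:
  fixes G :: "'a::euclidean_space \<Rightarrow> 'b::euclidean_space"
  assumes G: "integrable lborel G" and t: "0 \<le> t" "t \<le> 1" and e: "e > 0"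
  shows "\<exists>A\<in>sets borel.
    norm ((LINT w|lborel. indicator A w *\<^sub>R G w) - t *\<^sub>R (LINT w|lborel. G w)) < e"
proof -
  \<comment> \<open>Simple functions close to \<open>G\<close> in the L1 norm come with the
    definition of Bochner integrability. The error of \<open>e / 2\<close> is paid twice, under the
    indicator and in the scaled full integral.\<close>
  obtain s where s: "\<And>i. Bochner_Integration.simple_bochner_integrable lborel (s i)"
      and lim: "(\<lambda>i. \<integral>\<^sup>+w. norm (G w - s i w) \<partial>lborel) \<longlonglongrightarrow> 0"
    using G by (auto simp: integrable.simps has_bochner_integral.simps)
  have "\<forall>\<^sub>F i in sequentially. (\<integral>\<^sup>+w. norm (G w - s i w) \<partial>lborel) < ennreal (e / 2)"
    using e by (intro order_tendstoD[OF lim]) simp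
  then obtain i where i: "(\<integral>\<^sup>+w. norm (G w - s i w) \<partial>lborel) < ennreal (e / 2)"
    by (auto simp: eventually_sequentially)
  have si: "integrable lborel (s i)"
    using s by (rule integrableI_simple_bochner_integrable)
  hence diff: "integrable lborel (\<lambda>w. G w - s i w)"
    using G by simp
  have "ennreal (LINT w|lborel. norm (G w - s i w)) < ennreal (e / 2)"
    using i diff by (subst nn_integral_eq_integral[symmetric]) auto
  hence small: "(LINT w|lborel. norm (G w - s i w)) < e / 2"
    using e by (simp add: ennreal_less_iff)
  obtain A where A[measurable]: "A \<in> sets borel"
      and eq: "(LINT w|lborel. indicator A w *\<^sub>R s i w) = t *\<^sub>R (LINT w|lborel. s i w)"
    using simple_split_set[OF s t] by blast
  have int: "integrable lborel (\<lambda>w. indicator A w *\<^sub>R f w)" if "integrable lborel f" for f :: "'a \<Rightarrow> 'b"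
    using that by (intro integrable_mult_indicator) auto
  have 1: "norm (LINT w|lborel. indicator A w *\<^sub>R (G w - s i w)) \<le> (LINT w|lborel. norm (G w - s i w))"
    by (rule Bochner_Integration.integral_norm_bound_integral[OF int[OF diff] integrable_norm[OF diff]])
      (simp add: indicator_def)
  have 2: "norm (t *\<^sub>R (LINT w|lborel. G w - s i w)) \<le> (LINT w|lborel. norm (G w - s i w))"
    using t integral_norm_bound[of lborel "\<lambda>w. G w - s i w"]
    by (auto intro: order.trans[OF mult_left_le_one_le])
  have "(LINT w|lborel. indicator A w *\<^sub>R G w) - t *\<^sub>R (LINT w|lborel. G w)
      = (LINT w|lborel. indicator A w *\<^sub>R (G w - s i w)) - t *\<^sub>R (LINT w|lborel. G w - s i w)"
    using G si int eq by (simp add: scaleR_diff_right)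
  hence "norm ((LINT w|lborel. indicator A w *\<^sub>R G w) - t *\<^sub>R (LINT w|lborel. G w))
      \<le> norm (LINT w|lborel. indicator A w *\<^sub>R (G w - s i w)) + norm (t *\<^sub>R (LINT w|lborel. G w - s i w))"
    by (simp only: norm_triangle_ineq4)
  thus ?thesis
    using 1 2 small by (intro bexI[OF _ A]) linarith
qed

section \<open>The integrand of the Tsallis divergence\<close>

text \<open>The divergence written pointwise, uniformly in \<open>q\<close>: for a normalized
  density the constant -1 in \<open>tsallis_div\<close> becomes \<open>- a\<close> under the
  integral. At \<open>b = 0 < a\<close> the value is a finite default, so absolute continuity is
  carried along separately.\<close>

definition tsallis_integrand :: "real \<Rightarrow> real \<Rightarrow> real \<Rightarrow> real" where
  "tsallis_integrand q a b = - a * q_ln q (b / a)"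

lemma borel_measurable_q_ln [measurable]:
  "g \<in> borel_measurable M \<Longrightarrow> (\<lambda>w. q_ln q (g w)) \<in> borel_measurable M"
  unfolding q_ln_def by (cases "q = 1") auto

lemma borel_measurable_tsallis_integrand [measurable]:
  "g \<in> borel_measurable M \<Longrightarrow> h \<in> borel_measurable M \<Longrightarrow>
    (\<lambda>w. tsallis_integrand q (g w) (h w)) \<in> borel_measurable M"
  unfolding tsallis_integrand_def
  by (intro borel_measurable_times borel_measurable_uminus borel_measurable_q_ln borel_measurable_divide)

lemma tsallis_integrand_0 [simp]: "tsallis_integrand q 0 b = 0"
  by (simp add: tsallis_integrand_def)

lemma tsallis_integrand_one:
  assumes "a \<ge> 0" "b \<ge> 0"
  shows "tsallis_integrand 1 a b = a * ln (a / b)"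
  using assms
  by (cases "a = 0 \<or> b = 0") (auto simp: tsallis_integrand_def q_ln_def ln_div algebra_simps)

lemma tsallis_integrand_neq_one:
  assumes "a \<ge> 0" "b \<ge> 0" "q \<noteq> 1"
  shows "tsallis_integrand q a b = (a powr q * b powr (1 - q) - a) / (q - 1)"
proof (cases "a = 0")
  case False
  have "a * (b / a) powr (1 - q) = b powr (1 - q) * (a / a powr (1 - q))"
    using assms by (simp add: powr_divide)
  also have "a / a powr (1 - q) = a powr q"
    using assms False by (simp add: powr_diff)
  finally have *: "a * (b / a) powr (1 - q) = a powr q * b powr (1 - q)"
    by simp
  have "tsallis_integrand q a b = (a * (b / a) powr (1 - q) - a) / (q - 1)"
    using assms by (simp add: tsallis_integrand_def q_ln_def divide_simps) (simp add: algebra_simps)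
  thus ?thesis
    by (simp only: *)
qed simp

lemma tsallis_integrand_scale:
  assumes "c > 0" "a \<ge> 0" "b \<ge> 0" "b = 0 \<longrightarrow> a = 0"
  shows "tsallis_integrand q (c * a) b = c powr q * tsallis_integrand q a b - c * a * q_ln q (1 / c)"
proof (cases "a = 0")
  case False
  hence pos: "a > 0" "b > 0" using assms by auto
  have "q_ln q (b / (c * a)) = q_ln q (1 / c * (b / a))"
    by (simp add: field_simps)
  also have "\<dots> = q_ln q (1 / c) + (1 / c) powr (1 - q) * q_ln q (b / a)"
    using pos assms by (intro q_ln_mult) auto
  also have "(1 / c) powr (1 - q) = c powr (q - 1)"
    using assms by (simp add: powr_divide powr_minus_divide[symmetric])
  finally have 1: "q_ln q (b / (c * a)) = q_ln q (1 / c) + c powr (q - 1) * q_ln q (b / a)" .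
  have 2: "c * c powr (q - 1) = c powr q"
    using assms by (simp add: powr_diff)
  have "tsallis_integrand q (c * a) b
      = - c * a * q_ln q (1 / c) - a * ((c * c powr (q - 1)) * q_ln q (b / a))"
    unfolding tsallis_integrand_def 1 by (simp add: algebra_simps)
  thus ?thesis
    by (simp add: 2 tsallis_integrand_def algebra_simps)
qed simp

text \<open>\<open>q_ln_mult\<close> at \<open>b / a\<close> and the q-exponential yields the
  correction \<open>a * (b / a) powr (1 - q) * v\<close>; the power of \<open>b\<close> cancels
  against the factor \<open>b powr (q - 1)\<close> in \<open>v\<close>, leaving
  \<open>l * a powr q\<close>.\<close>

lemma tsallis_integrand_tilt:
  assumes "a \<ge> 0" "b > 0" and v: "0 < 1 + (1 - q) * (b powr (q - 1) * l)"
  shows "tsallis_integrand q a b - l * a powr q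
    = tsallis_integrand q a (b * q_exp q (b powr (q - 1) * l))"
proof (cases "a = 0")
  case False
  hence a: "a > 0" using assms by simp
  define v where "v = b powr (q - 1) * l"
  have "q_ln q (b * q_exp q v / a) = q_ln q (b / a * q_exp q v)"
    by simp
  also have "\<dots> = q_ln q (b / a) + (b / a) powr (1 - q) * v"
    using a assms q_exp_pos[of q v] by (subst q_ln_mult) (auto simp: q_ln_q_exp v_def)
  finally have "tsallis_integrand q a (b * q_exp q v)
      = tsallis_integrand q a b - a * ((b / a) powr (1 - q) * v)"
    by (simp add: tsallis_integrand_def algebra_simps)
  also have "a * ((b / a) powr (1 - q) * v) = (a / a powr (1 - q)) * (b powr (1 - q) * b powr (q - 1)) * l"
    using a assms by (simp add: powr_divide v_def)
  also have "a / a powr (1 - q) = a powr q"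
    using a by (simp add: powr_diff)
  also have "b powr (1 - q) * b powr (q - 1) = 1"
    using assms by (simp flip: powr_add)
  finally show ?thesis
    by (simp add: v_def mult.commute)
qed simp

text \<open>Same left side as in \<open>tsallis_integrand_tilt\<close>, but for a base of any sign.
  The base appears as a factor, which makes the cases at and beyond the pole of the q-exponential
  tractable.\<close>

lemma tsallis_integrand_tilt_neq_one:
  assumes "a \<ge> 0" "b > 0" "q \<noteq> 1"
  shows "tsallis_integrand q a b - l * a powr q
    = (a powr q * b powr (1 - q) * (1 + (1 - q) * (b powr (q - 1) * l)) - a) / (q - 1)"
proof -
  have "b powr (1 - q) * b powr (q - 1) = 1"
    using assms by (simp flip: powr_add)
  hence "a powr q * b powr (1 - q) * (1 + (1 - q) * (b powr (q - 1) * l))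
      = a powr q * b powr (1 - q) + (1 - q) * l * a powr q"
    by (simp add: algebra_simps)
  thus ?thesis
    using assms by (simp add: tsallis_integrand_neq_one divide_simps) (simp add: algebra_simps)
qed

text \<open>A minorant affine in \<open>a\<close> that touches at \<open>a = r / Z\<close>; if
  \<open>r\<close> has mass \<open>Z\<close> and \<open>a\<close> has mass 1, it integrates to
  \<open>- q_ln q Z\<close>. For nonzero \<open>a\<close> the gap is a nonnegative multiple of
  \<open>u - 1 - q_ln q u\<close>.\<close>

lemma tsallis_integrand_tangent:
  assumes q: "q \<ge> 1" and "a \<ge> 0" "r > 0" "Z > 0"
  shows "- (a * q_ln q Z) - Z powr (1 - q) * (r / Z - a) \<le> tsallis_integrand q a r" (is ?le)
    and "- (a * q_ln q Z) - Z powr (1 - q) * (r / Z - a) = tsallis_integrand q a r \<Longrightarrow> a = r / Z"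
proof -
  define u where "u = r / Z / a"
  have eq: "tsallis_integrand q a r - (- (a * q_ln q Z) - Z powr (1 - q) * (r / Z - a))
      = Z powr (1 - q) * (a * (u - 1 - q_ln q u))" if "a \<noteq> 0"
  proof -
    have "u > 0" using assms that by (simp add: u_def)
    have "q_ln q (r / a) = q_ln q (Z * u)"
      using assms by (simp add: u_def)
    also have "\<dots> = q_ln q Z + Z powr (1 - q) * q_ln q u"
      using assms \<open>u > 0\<close> by (intro q_ln_mult) auto
    finally have 1: "q_ln q (r / a) = q_ln q Z + Z powr (1 - q) * q_ln q u" .
    have 2: "r / Z = a * u"
      using that by (simp add: u_def)
    show ?thesis
      unfolding tsallis_integrand_def 1 2 by (simp add: algebra_simps)
  qed
  \<comment> \<open>At \<open>a = 0\<close> the minorant is strictly negative while the integrand is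
    0, so equality cannot occur there.\<close>
  have zero: "Z powr (1 - q) * (r / Z) > 0"
    using assms by simp
  show ?le
  proof (cases "a = 0")
    case False
    hence "u > 0" using assms by (simp add: u_def)
    hence "0 \<le> Z powr (1 - q) * (a * (u - 1 - q_ln q u))"
      using q_ln_le_minus_one[OF q, of u] assms by simp
    thus ?thesis using eq[OF False] by linarith
  qed (use zero in simp)
  assume *: "- (a * q_ln q Z) - Z powr (1 - q) * (r / Z - a) = tsallis_integrand q a r"
  show "a = r / Z"
  proof (cases "a = 0")
    case False
    hence "u > 0" using assms by (simp add: u_def)
    have "q_ln q u = u - 1"
      using eq[OF False] * False assms by simp
    hence "u = 1"
      using q_ln_eq_minus_one[OF q \<open>u > 0\<close>] by simp
    thus ?thesis using False assms by (simp add: u_def field_simps)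
  next
    case True
    thus ?thesis using assms * by auto
  qed
qed

text \<open>Both bounds come from \<open>q_ln q u \<le> u - 1\<close>: directly for the lower one,
  at \<open>1 / u\<close> for the upper one. They make the divergence integrable for bounded
  functions supported where the prior lies between \<open>1 / n\<close> and
  \<open>n\<close>.\<close>

lemma tsallis_integrand_bound:
  assumes q: "q \<ge> 1" and "0 \<le> a" "a \<le> M" "1 / n \<le> b" "b \<le> n" "n > 0"
  shows "\<bar>tsallis_integrand q a b\<bar> \<le> n + M * (M * n) powr q"
proof (cases "a = 0")
  case True
  thus ?thesis using assms by simp
next
  case False
  hence a: "a > 0" using assms by simp
  have b: "b > 0"
    using assms by (meson divide_pos_pos less_le_trans zero_less_one)
  define u where "u = b / a"
  have u: "u > 0" using a b by (simp add: u_def)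
  have "0 = q_ln q u + u powr (1 - q) * q_ln q (1 / u)"
    using q_ln_mult[of u "1 / u" q] u by simp
  also have "u powr (1 - q) * q_ln q (1 / u) \<le> u powr (1 - q) * (1 / u - 1)"
    using q_ln_le_minus_one[OF q, of "1 / u"] u by (intro mult_left_mono) auto
  also have "\<dots> \<le> u powr (1 - q) * (1 / u)"
    by (intro mult_left_mono) auto
  also have "\<dots> = (1 / u) powr q"
    using u by (simp add: powr_diff powr_divide)
  finally have "a * (- q_ln q u) \<le> a * (1 / u) powr q"
    using a by (intro mult_left_mono) auto
  also have "(1 / u) powr q \<le> (M * n) powr q"
  proof (rule powr_mono2)
    have "a * (1 / b) \<le> M * n"
      using assms b by (intro mult_mono) (auto simp: field_simps)
    thus "1 / u \<le> M * n" by (simp add: u_def)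
  qed (use q u in auto)
  hence "a * (1 / u) powr q \<le> M * (M * n) powr q"
    using assms by (intro mult_mono) auto
  finally have upper: "tsallis_integrand q a b \<le> M * (M * n) powr q"
    by (simp add: tsallis_integrand_def u_def)
  have "a * q_ln q u \<le> a * (u - 1)"
    using q_ln_le_minus_one[OF q u] a by (intro mult_left_mono) auto
  also have "\<dots> \<le> n"
    using a assms by (simp add: u_def right_diff_distrib)
  finally have "- n \<le> tsallis_integrand q a b"
    by (simp add: tsallis_integrand_def u_def)
  moreover have "0 \<le> M * (M * n) powr q"
    using assms by (intro mult_nonneg_nonneg) auto
  ultimately show ?thesis
    using upper assms by (intro abs_leI) linarith+
qed

lemma borel_measurable_q_exp:
  "g \<in> borel_measurable M \<Longrightarrow> (\<lambda>w. q_exp q (g w)) \<in> borel_measurable M"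
  unfolding q_exp_def by (cases "q = 1") auto

lemma borel_measurable_q_exp_ext:
  "g \<in> borel_measurable M \<Longrightarrow> (\<lambda>w. q_exp_ext q (g w)) \<in> borel_measurable M"
  unfolding q_exp_ext_def using borel_measurable_q_exp[of g M q]
  by (cases "q > 1") (simp_all, measurable)

text \<open>A countable union of null sets is null. Boundedness of the pieces matters because
  \<open>measure\<close> is 0 also on sets of infinite measure.\<close>

lemma exists_positive_piece:
  fixes S :: "nat \<Rightarrow> 'a::euclidean_space set"
  assumes [measurable]: "\<And>n. S n \<in> sets borel" and bounded: "\<And>n. bounded (S n)"
    and "\<not> (AE w in lborel. w \<notin> (\<Union>n. S n))"
  shows "\<exists>n. 0 < measure lborel (S n)"
proof (rule ccontr)
  assume "\<not> (\<exists>n. 0 < measure lborel (S n))"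
  hence zero: "measure lborel (S n) = 0" for n
    by (metis measure_nonneg less_eq_real_def)
  have "S n \<in> null_sets lborel" for n
  proof (rule null_setsI)
    show "emeasure lborel (S n) = 0"
      using zero[of n] emeasure_bounded_finite[OF bounded[of n]]
      by (simp add: emeasure_eq_ennreal_measure)
  qed simp
  hence "(\<Union>n. S n) \<in> null_sets lborel"
    by blast
  thus False
    using assms(3) AE_not_in by blast
qed

section \<open>Conjugate of the loss\<close>

text \<open>The Fenchel-Young inequality at \<open>z = 0\<close>, where the loss equals 1.\<close>

lemma tsallis_term_nonneg:
  assumes "s > 1" "b \<ge> 0"
  shows "0 \<le> tsallis_term s b"
  using q_exp_linear_lower[of "1 / s" b 0] assms by (simp add: q_exp_def split: if_splits)

lemma tsallis_term_eq:
  assumes "s > 1"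
  shows "tsallis_term s b = b powr s * (1 / (s - 1)) - b * (1 + 1 / (s - 1)) + 1"
proof -
  have "s * b / (s - 1) = b * (1 + 1 / (s - 1))" "(s - 1) / (s - 1) = 1"
    using assms by (simp_all add: field_simps)
  thus ?thesis
    using assms by (simp add: tsallis_term_def add_divide_distrib diff_divide_distrib)
qed

lemma tendsto_inverse_pred: "((\<lambda>s::real. 1 / (s - 1)) \<longlongrightarrow> 0) at_top"
  using filterlim_tendsto_add_at_top[OF tendsto_const[of "-1"] filterlim_ident]
  by (intro tendsto_divide_0[OF tendsto_const] filterlim_at_top_imp_at_infinity) simp

lemma tsallis_term_tendsto:
  assumes "0 \<le> b" "b \<le> 1"
  shows "((\<lambda>s. tsallis_term s b) \<longlongrightarrow> 1 - b) at_top"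
proof -
  have "((\<lambda>s. b powr s * (1 / (s - 1))) \<longlongrightarrow> 0) at_top"
  proof (rule Lim_null_comparison[OF _ tendsto_inverse_pred])
    show "\<forall>\<^sub>F s in at_top. norm (b powr s * (1 / (s - 1))) \<le> 1 / (s - 1)"
      using eventually_gt_at_top[of 1]
    proof eventually_elim
      case (elim s)
      have "b powr s \<le> 1 powr s"
        using assms elim by (intro powr_mono2) auto
      thus ?case using elim by (simp add: divide_right_mono)
    qed
  qed
  from tendsto_add[OF tendsto_diff[OF this tendsto_mult[OF tendsto_const[of b]
        tendsto_add[OF tendsto_const[of 1] tendsto_inverse_pred]]] tendsto_const[of 1]]
  have "((\<lambda>s. b powr s * (1 / (s - 1)) - b * (1 + 1 / (s - 1)) + 1) \<longlongrightarrow> 1 - b) at_top"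
    by simp
  moreover have "\<forall>\<^sub>F s in at_top. b powr s * (1 / (s - 1)) - b * (1 + 1 / (s - 1)) + 1 = tsallis_term s b"
    using eventually_gt_at_top[of 1] by eventually_elim (simp add: tsallis_term_eq)
  ultimately show ?thesis
    by (rule Lim_transform_eventually)
qed

text \<open>With \<open>l = ln b\<close>, the quadratic Taylor bound for \<open>exp (s * l)\<close>
  still leaves linear growth of slope \<open>l^2 / 2\<close> after division by \<open>s - 1\<close>,
  while the subtracted term is at most \<open>2 * b\<close> for \<open>s \<ge> 2\<close>.\<close>

lemma tsallis_term_at_top:
  assumes "b > 1"
  shows "filterlim (\<lambda>s. tsallis_term s b) at_top at_top"
proof (rule filterlim_at_top_mono)
  define l where "l = ln b"
  have l: "l > 0" using assms by (simp add: l_def)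
  show "filterlim (\<lambda>s. - (2 * b) + l\<^sup>2 / 2 * s) at_top at_top"
    using l by (intro filterlim_tendsto_add_at_top[OF tendsto_const]
        filterlim_tendsto_pos_mult_at_top[OF tendsto_const] filterlim_ident) auto
  show "\<forall>\<^sub>F s in at_top. - (2 * b) + l\<^sup>2 / 2 * s \<le> tsallis_term s b"
    using eventually_ge_at_top[of 2]
  proof eventually_elim
    case (elim s)
    have "(s * l)\<^sup>2 / 2 \<le> exp (s * l)"
      using exp_lower_Taylor_quadratic[of "s * l"] elim l by (simp add: field_simps) (smt (verit) mult_nonneg_nonneg)
    also have "exp (s * l) = b powr s"
      using assms by (simp add: powr_def l_def)
    finally have "(s * l)\<^sup>2 / 2 * (1 / (s - 1)) \<le> b powr s * (1 / (s - 1))"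
      using elim by (intro mult_right_mono) auto
    moreover have "l\<^sup>2 / 2 * s \<le> (s * l)\<^sup>2 / 2 * (1 / (s - 1))"
    proof -
      have "s \<le> s * s * (1 / (s - 1))"
        using elim by (simp add: divide_simps algebra_simps)
      hence "l\<^sup>2 / 2 * s \<le> l\<^sup>2 / 2 * (s * s * (1 / (s - 1)))"
        by (intro mult_left_mono) auto
      thus ?thesis by (simp add: power2_eq_square mult_ac)
    qed
    moreover have "b * (1 + 1 / (s - 1)) \<le> b * 2"
      using elim assms by (intro mult_left_mono) (auto simp: divide_simps)
    moreover have "tsallis_term s b = b powr s * (1 / (s - 1)) - b * (1 + 1 / (s - 1)) + 1"
      using elim by (intro tsallis_term_eq) auto
    ultimately show ?case
      by linarith
  qed
qed

lemma gen_tsallis_div_infinity_finite: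
  fixes b :: "real ^ 'm::finite"
  assumes "\<And>i. 0 \<le> b $ i" "\<And>i. b $ i \<le> 1"
  shows "gen_tsallis_div_ext \<infinity> b (\<chi> i. 1) = ereal (\<Sum>i\<in>UNIV. 1 - b $ i)"
proof -
  have "((\<lambda>s. ereal (gen_tsallis_div s b (\<chi> i. 1))) \<longlongrightarrow> ereal (\<Sum>i\<in>UNIV. 1 - b $ i)) at_top"
    unfolding gen_tsallis_div_ones using assms
    by (intro tendsto_intros tsallis_term_tendsto) auto
  thus ?thesis
    by (simp add: gen_tsallis_div_ext_def tendsto_Lim)
qed

lemma gen_tsallis_div_infinity_infinite:
  fixes b :: "real ^ 'm::finite"
  assumes "\<And>i. 0 \<le> b $ i" "b $ j > 1"
  shows "gen_tsallis_div_ext \<infinity> b (\<chi> i. 1) = \<infinity>"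
proof -
  have "filterlim (\<lambda>s. gen_tsallis_div s b (\<chi> i. 1)) at_top at_top"
  proof (rule filterlim_at_top_mono[OF tsallis_term_at_top[OF assms(2)]])
    show "\<forall>\<^sub>F s in at_top. tsallis_term s (b $ j) \<le> gen_tsallis_div s b (\<chi> i. 1)"
      using eventually_gt_at_top[of 1]
    proof eventually_elim
      case (elim s)
      thus ?case
        unfolding gen_tsallis_div_ones using assms
        by (intro member_le_sum tsallis_term_nonneg) auto
    qed
  qed
  hence "((\<lambda>s. ereal (gen_tsallis_div s b (\<chi> i. 1))) \<longlongrightarrow> \<infinity>) at_top"
    by (simp add: tendsto_PInfty filterlim_at_top_dense)
  thus ?thesis
    by (simp add: gen_tsallis_div_ext_def tendsto_Lim)
qed

text \<open>Hides the different shapes of the loss from the duality argument: either every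
  coordinate has a finite infimum \<open>v i\<close> and the divergence sums the
  \<open>1 - v i\<close>, or the divergence is infinite and some coordinate is unbounded below. The
  second case arises for the hinge with a slope above 1.\<close>

lemma gen_tsallis_div_conjugate:
  fixes b :: "real ^ 'm::finite"
  assumes q': "0 \<le> q'" "q' \<le> 1" and b: "\<And>i. 0 \<le> b $ i"
  shows "(\<exists>v. (\<forall>i z. v i \<le> q_exp q' (- z) + b $ i * z) \<and>
        (\<forall>i e. e > 0 \<longrightarrow> (\<exists>z. q_exp q' (- z) + b $ i * z < v i + e)) \<and>
        gen_tsallis_div_ext (1 / ereal q') b (\<chi> i. 1) = ereal (\<Sum>i\<in>UNIV. 1 - v i)) \<or>
      (gen_tsallis_div_ext (1 / ereal q') b (\<chi> i. 1) = \<infinity> \<and>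
        (\<exists>j. \<forall>c. \<exists>z. q_exp q' (- z) + b $ j * z < c))"
proof (cases "q' = 0")
  case False
  hence "0 < q'" using q' by simp
  hence "gen_tsallis_div_ext (1 / ereal q') b (\<chi> i. 1) = ereal (\<Sum>i\<in>UNIV. 1 - (1 - tsallis_term (1 / q') (b $ i)))"
    by (simp add: gen_tsallis_div_ext_def gen_tsallis_div_ones one_ereal_def)
  thus ?thesis
    using q_exp_linear_lower[OF \<open>0 < q'\<close> q'(2) b] q_exp_linear_approx[OF \<open>0 < q'\<close> q'(2) b]
    by (intro disjI1 exI[of _ "\<lambda>i. 1 - tsallis_term (1 / q') (b $ i)"]) blast
next
  case True
  have inf: "1 / ereal q' = \<infinity>"
    using True by (simp add: divide_ereal_def zero_ereal_def[symmetric])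
  show ?thesis
  proof (cases "\<forall>i. b $ i \<le> 1")
    case le: True
    have "\<exists>z. q_exp q' (- z) + b $ i * z < b $ i + e" if "e > 0" for i e
      using that True by (intro exI[of _ 1]) (simp add: q_exp_def)
    thus ?thesis
      unfolding inf using gen_tsallis_div_infinity_finite[OF b, of] le hinge_linear_lower[OF b] True
      by (intro disjI1 exI[of _ "\<lambda>i. b $ i"]) auto
  next
    case False
    then obtain j where "b $ j > 1" by (auto simp: not_le)
    thus ?thesis
      unfolding inf using gen_tsallis_div_infinity_infinite[OF b, of j] hinge_linear_unbounded[of "b $ j"] True
      by blast
  qed
qed

text \<open>Serves to turn a bound on the sum of the infima over \<open>p\<close> and over
  \<open>z\<close> into separate bounds; either infimum may be minus infinity.\<close>

lemma ereal_add_less_real_split: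
  fixes a b :: ereal
  assumes "a \<noteq> \<infinity>" "b \<noteq> \<infinity>" "a + b < ereal c"
  shows "\<exists>c1 c2. a < ereal c1 \<and> b < ereal c2 \<and> c1 + c2 \<le> c"
proof (cases a)
  case (real r)
  show ?thesis
  proof (cases b)
    case b: (real s)
    hence "r + s < c" using assms real by simp
    thus ?thesis using real b
      by (intro exI[of _ "r + (c - r - s) / 2"] exI[of _ "s + (c - r - s) / 2"]) (simp add: field_simps)
  next
    case MInf
    thus ?thesis using real
      by (intro exI[of _ "r + 1"] exI[of _ "c - (r + 1)"]) auto
  qed (use assms in auto)
next
  case MInf
  obtain s where "b < ereal s"
    using assms(2) by (cases b) (auto intro: that[of "real_of_ereal b + 1"] that[of 0])
  thus ?thesis using MInf
    by (intro exI[of _ "c - s"] exI[of _ s]) auto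
qed (use assms in auto)

section \<open>Duality\<close>

locale tsallis_problem =
  fixes q q' C :: real and p0 :: "real ^ 'd::finite \<Rightarrow> real"
    and y :: "'m::finite \<Rightarrow> real" and f :: "'m \<Rightarrow> real ^ 'd"
  assumes q: "1 \<le> q" and q': "0 \<le> q'" "q' \<le> 1" and C: "0 < C"
    and prior: "prob_density p0"
begin

section \<open>Admissible densities and their normalization\<close>

definition "score i w = y i * (f i \<bullet> w)"

definition "margins p = (\<chi> i. q_margin q y f p i)"

abbreviation "adm \<equiv> admissible_density q p0 y f"

lemma p0_measurable [measurable]: "p0 \<in> borel_measurable borel"
  and p0_nonneg: "0 \<le> p0 w"
  and p0_integrable: "integrable lborel p0"
  and p0_integral: "(LINT w|lborel. p0 w) = 1"
  using prior by (auto simp: prob_density_def has_bochner_integral_iff)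

lemma score_measurable [measurable]: "score i \<in> borel_measurable borel"
  unfolding score_def by measurable

text \<open>Admissibility without the mass condition. Switching between densities and truncating the
  tilted prior produce functions of this kind, whose mass is corrected afterwards.\<close>

definition integrands_integrable :: "(real ^ 'd \<Rightarrow> real) \<Rightarrow> bool" where
  "integrands_integrable p \<longleftrightarrow> p \<in> borel_measurable borel \<and> (\<forall>w. 0 \<le> p w) \<and> integrable lborel p \<and>
    (AE w in lborel. p0 w = 0 \<longrightarrow> p w = 0) \<and>
    integrable lborel (\<lambda>w. tsallis_integrand q (p w) (p0 w)) \<and>
    (\<forall>i. integrable lborel (\<lambda>w. score i w * p w powr q))"

lemma divergence_integrable_iff:
  assumes "p \<in> borel_measurable borel" "\<And>w. 0 \<le> p w" "integrable lborel p"
  shows "integrable lborel (\<lambda>w. tsallis_integrand q (p w) (p0 w)) \<longleftrightarrow>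
    (if q = 1 then integrable lborel (\<lambda>w. p w * ln (p w / p0 w))
      else integrable lborel (\<lambda>w. p w powr q * p0 w powr (1 - q)))"
proof (cases "q = 1")
  case False
  have eq: "(\<lambda>w. tsallis_integrand q (p w) (p0 w))
      = (\<lambda>w. (p w powr q * p0 w powr (1 - q) - p w) / (q - 1))"
    using assms False p0_nonneg by (simp add: tsallis_integrand_neq_one)
  let ?X = "\<lambda>w. p w powr q * p0 w powr (1 - q)"
  have cancel: "(\<lambda>w. (q - 1) * ((?X w - p w) / (q - 1)) + p w) = ?X"
    using False by auto
  have "integrable lborel ?X" if "integrable lborel (\<lambda>w. (?X w - p w) / (q - 1))"
  proof -
    have "integrable lborel (\<lambda>w. (q - 1) * ((?X w - p w) / (q - 1)) + p w)"
      using that assms(3) by (intro Bochner_Integration.integrable_add integrable_mult_right)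
    thus ?thesis unfolding cancel .
  qed
  moreover have "integrable lborel (\<lambda>w. (?X w - p w) / (q - 1))" if "integrable lborel ?X"
    using that assms(3) by (intro integrable_divide Bochner_Integration.integrable_diff)
  ultimately show ?thesis
    unfolding eq using False by argo
qed (use assms p0_nonneg in \<open>simp add: tsallis_integrand_one\<close>)

lemma adm_iff:
  "adm p \<longleftrightarrow> integrands_integrable p \<and> (LINT w|lborel. p w) = 1"
  unfolding admissible_density_def integrands_integrable_def tsallis_div_finite_def prob_density_def
    has_bochner_integral_iff score_def
  using divergence_integrable_iff[of p] by auto

lemma tsallis_div_eq_integral:
  assumes "adm p"
  shows "tsallis_div q p p0 = (LINT w|lborel. tsallis_integrand q (p w) (p0 w))"
proof -
  have p: "integrable lborel p" "(LINT w|lborel. p w) = 1" "\<And>w. 0 \<le> p w"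
    using assms by (auto simp: adm_iff integrands_integrable_def)
  show ?thesis
  proof (cases "q = 1")
    case True
    thus ?thesis
      using p p0_nonneg by (simp add: tsallis_div_def tsallis_integrand_one)
  next
    case False
    have "integrable lborel (\<lambda>w. p w powr q * p0 w powr (1 - q))"
      using assms False divergence_integrable_iff[of p] by (auto simp: adm_iff integrands_integrable_def)
    thus ?thesis
      using False p p0_nonneg by (simp add: tsallis_div_def tsallis_integrand_neq_one)
  qed
qed

lemma margins_nth: "margins p $ i = (LINT w|lborel. score i w * p w powr q)"
  by (simp add: margins_def q_margin_def score_def)

text \<open>Division by the mass multiplies terms of degree \<open>q\<close> by
  \<open>(1 / m) powr q\<close> and shifts the divergence by \<open>q_ln q m\<close>; both effects
  disappear as \<open>m\<close> tends to 1.\<close>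

lemma normalized_adm:
  assumes p: "integrands_integrable p" and m: "m > 0" "(LINT w|lborel. p w) = m"
  shows "adm (\<lambda>w. 1 / m * p w)"
    and "tsallis_div q (\<lambda>w. 1 / m * p w) p0
      = (1 / m) powr q * (LINT w|lborel. tsallis_integrand q (p w) (p0 w)) - q_ln q m"
    and "margins (\<lambda>w. 1 / m * p w) = (1 / m) powr q *\<^sub>R (\<chi> i. LINT w|lborel. score i w * p w powr q)"
proof -
  have p': "p \<in> borel_measurable borel" "\<And>w. 0 \<le> p w" "integrable lborel p"
    "AE w in lborel. p0 w = 0 \<longrightarrow> p w = 0"
    "integrable lborel (\<lambda>w. tsallis_integrand q (p w) (p0 w))"
    "\<And>i. integrable lborel (\<lambda>w. score i w * p w powr q)"
    using p by (auto simp: integrands_integrable_def)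
  note [measurable] = p'(1)
  have AE: "AE w in lborel. tsallis_integrand q (1 / m * p w) (p0 w)
      = (1 / m) powr q * tsallis_integrand q (p w) (p0 w) - 1 / m * p w * q_ln q m"
    using p'(4)
  proof eventually_elim
    case (elim w)
    thus ?case
      using tsallis_integrand_scale[of "1 / m" "p w" "p0 w" q] m p0_nonneg[of w] p'(2)[of w] by simp
  qed
  have score: "score i w * (1 / m * p w) powr q = (1 / m) powr q * (score i w * p w powr q)" for i w
    using m p'(2)[of w] by (simp add: powr_mult powr_divide)
  have int: "integrable lborel (\<lambda>w. (1 / m) powr q * tsallis_integrand q (p w) (p0 w) - 1 / m * p w * q_ln q m)"
    using p'(3,5) by (intro Bochner_Integration.integrable_diff) auto
  have int': "integrable lborel (\<lambda>w. tsallis_integrand q (1 / m * p w) (p0 w))"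
    by (rule integrable_cong_AE_imp[OF int]) (use AE in \<open>auto elim: eventually_mono\<close>)
  show adm: "adm (\<lambda>w. 1 / m * p w)"
    unfolding adm_iff integrands_integrable_def score
    using p' m int' by (auto elim: eventually_mono)
  have "tsallis_div q (\<lambda>w. 1 / m * p w) p0
      = (LINT w|lborel. (1 / m) powr q * tsallis_integrand q (p w) (p0 w) - 1 / m * p w * q_ln q m)"
    unfolding tsallis_div_eq_integral[OF adm] using AE by (intro integral_cong_AE) measurable
  also have "\<dots> = (1 / m) powr q * (LINT w|lborel. tsallis_integrand q (p w) (p0 w)) - q_ln q m"
    using p'(3,5) m by (subst Bochner_Integration.integral_diff) auto
  finally show "tsallis_div q (\<lambda>w. 1 / m * p w) p0
      = (1 / m) powr q * (LINT w|lborel. tsallis_integrand q (p w) (p0 w)) - q_ln q m" .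
  show "margins (\<lambda>w. 1 / m * p w) = (1 / m) powr q *\<^sub>R (\<chi> i. LINT w|lborel. score i w * p w powr q)"
    unfolding vec_eq_iff margins_nth score by simp
qed

section \<open>Convexity of the closure of the attainable pairs\<close>

definition "attainable = {(tsallis_div q p p0, margins p) |p. adm p}"

text \<open>
  Switching between two densities on a set that splits all the integrals in the ratio
  \<open>t : 1 - t\<close> makes up for the margins being nonlinear in the density.
\<close>

lemma convex_closure_attainable: "convex (closure attainable)"
proof -
  have combo: "t *\<^sub>R v1 + (1 - t) *\<^sub>R v2 \<in> closure attainable"
    if v: "v1 \<in> attainable" "v2 \<in> attainable" and t: "0 \<le> t" "t \<le> 1" for v1 v2 t
  proof -
    obtain p1 p2 where p: "adm p1" "adm p2"
        and v1: "v1 = (tsallis_div q p1 p0, margins p1)"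
        and v2: "v2 = (tsallis_div q p2 p0, margins p2)"
      using v by (auto simp: attainable_def)
    define T where "T p w = tsallis_integrand q (p w) (p0 w)" for p w
    have props: "p \<in> borel_measurable borel" "\<And>w. 0 \<le> p w" "integrable lborel p"
        "AE w in lborel. p0 w = 0 \<longrightarrow> p w = 0" "integrable lborel (T p)"
        "\<And>i. integrable lborel (\<lambda>w. score i w * p w powr q)" "(LINT w|lborel. p w) = 1" if "adm p" for p
      using that by (auto simp: adm_iff integrands_integrable_def T_def[abs_def])
    note p1 = props[OF p(1)] and p2 = props[OF p(2)]
    note [measurable] = p1(1) p2(1)
    define S where "S w = (\<chi> i. score i w * p1 w powr q - score i w * p2 w powr q)" for w
    \<comment> \<open>Mass, divergence and margins form one vector, so that a single set splits them
      all. Differences suffice: switching adds the integral of the difference over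
      \<open>A n\<close> to the value for \<open>p2\<close>.\<close>
    define G where "G w = (p1 w - p2 w, T p1 w - T p2 w, S w)" for w
    have S: "integrable lborel S"
    proof -
      have "integrable lborel (\<lambda>w. \<Sum>i\<in>UNIV. (score i w * p1 w powr q - score i w * p2 w powr q) *\<^sub>R axis i (1::real))"
        using p1(6) p2(6) by (intro Bochner_Integration.integrable_sum integrable_scaleR_left) auto
      moreover have "(\<Sum>i\<in>UNIV. (score i w * p1 w powr q - score i w * p2 w powr q) *\<^sub>R axis i (1::real)) = S w" for w
        by (simp add: S_def vec_eq_iff axis_def if_distrib[of "\<lambda>u. _ * u"] cong: if_cong)
      ultimately show ?thesis by simp
    qed
    have G: "integrable lborel G"
    proof -
      have "integrable lborel (\<lambda>w. (p1 w - p2 w) *\<^sub>R (1, 0, 0::real^'m) + (T p1 w - T p2 w) *\<^sub>R (0, 1, 0)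
          + (0::real, 0::real, S w))"
      proof (intro Bochner_Integration.integrable_add integrable_scaleR_left)
        have "bounded_linear (\<lambda>x. (0::real, 0::real, x::real^'m))"
          by (intro bounded_linear_Pair bounded_linear_zero bounded_linear_ident)
        from integrable_bounded_linear[OF this S] show "integrable lborel (\<lambda>w. (0::real, 0::real, S w))" .
      qed (use p1 p2 in auto)
      thus ?thesis by (simp add: G_def[abs_def])
    qed
    have "\<forall>n. \<exists>A. A \<in> sets borel \<and> norm ((LINT w|lborel. indicator A w *\<^sub>R G w) - t *\<^sub>R (LINT w|lborel. G w)) < 1 / Suc n"
      using approximate_split_set[OF G t] by (simp add: Bex_def)
    from choice[OF this] obtain A where A [measurable]: "\<And>n. A n \<in> sets borel"
        and err: "\<And>n. norm ((LINT w|lborel. indicator (A n) w *\<^sub>R G w) - t *\<^sub>R (LINT w|lborel. G w)) < 1 / Suc n"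
      by blast
    have lim: "(\<lambda>n. LINT w|lborel. indicator (A n) w *\<^sub>R G w) \<longlonglongrightarrow> t *\<^sub>R (LINT w|lborel. G w)"
      by (rule LIM_zero_cancel, rule Lim_null_comparison[OF _ lim_1_over_n[THEN LIMSEQ_Suc]])
        (use err in \<open>auto intro!: always_eventually less_imp_le\<close>)
    have pick: "(LINT w|lborel. indicator B w *\<^sub>R L (G w)) = L (LINT w|lborel. indicator B w *\<^sub>R G w)"
      if "bounded_linear L" "B \<in> sets borel" for L :: "_ \<Rightarrow> real" and B
    proof -
      interpret bounded_linear L by fact
      have "integrable lborel (\<lambda>w. indicator B w *\<^sub>R G w)"
        using G that by (intro integrable_mult_indicator) auto
      from integral_bounded_linear[OF that(1) this] show ?thesis
        by (simp add: scaleR)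
    qed
    have pick_lim: "(\<lambda>n. LINT w|lborel. indicator (A n) w * L (G w)) \<longlonglongrightarrow> t * (LINT w|lborel. L (G w))"
      if L: "bounded_linear L" for L :: "_ \<Rightarrow> real"
      using bounded_linear.tendsto[OF L lim] pick[OF L A] integral_bounded_linear[OF L G]
      by (simp add: linear_cmul[OF bounded_linear.linear[OF L]])
    define r where "r n w = indicator (A n) w * p1 w + (1 - indicator (A n) w) * p2 w" for n w
    have r: "r n w = (if w \<in> A n then p1 w else p2 w)" for n w
      by (simp add: r_def)
    \<comment> \<open>A switch commutes with every pointwise function \<open>F\<close>, in
      particular with the power \<open>q\<close>; a mixture of the two densities would not.\<close>
    have switch: "(\<lambda>w. F w (r n w)) = (\<lambda>w. F w (p2 w) + indicator (A n) w * (F w (p1 w) - F w (p2 w)))"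
      for n and F :: "real^'d \<Rightarrow> real \<Rightarrow> real"
      by (auto simp: r)
    have switch_int: "integrable lborel (\<lambda>w. F w (r n w))"
        "(LINT w|lborel. F w (r n w)) = (LINT w|lborel. F w (p2 w))
          + (LINT w|lborel. indicator (A n) w * (F w (p1 w) - F w (p2 w)))"
      if "integrable lborel (\<lambda>w. F w (p1 w))" "integrable lborel (\<lambda>w. F w (p2 w))"
      for n and F :: "real^'d \<Rightarrow> real \<Rightarrow> real"
    proof -
      have "integrable lborel (\<lambda>w. indicator (A n) w *\<^sub>R (F w (p1 w) - F w (p2 w)))"
        using that by (intro integrable_mult_indicator) auto
      thus "integrable lborel (\<lambda>w. F w (r n w))"
        "(LINT w|lborel. F w (r n w)) = (LINT w|lborel. F w (p2 w))
          + (LINT w|lborel. indicator (A n) w * (F w (p1 w) - F w (p2 w)))"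
        using that by (simp_all add: switch[of F])
    qed
    have rint: "integrands_integrable (r n)" for n
      unfolding integrands_integrable_def
    proof (intro conjI allI)
      show "r n \<in> borel_measurable borel"
        unfolding r_def by measurable
      show "AE w in lborel. p0 w = 0 \<longrightarrow> r n w = 0"
        using p1(4) p2(4) by eventually_elim (auto simp: r)
      show "integrable lborel (r n)"
        using switch_int(1)[of "\<lambda>w x. x" n] p1(3) p2(3) by simp
      show "integrable lborel (\<lambda>w. tsallis_integrand q (r n w) (p0 w))"
        using switch_int(1)[of "\<lambda>w x. tsallis_integrand q x (p0 w)" n] p1(5) p2(5) by (simp add: T_def[abs_def])
      show "integrable lborel (\<lambda>w. score i w * r n w powr q)" for i
        using switch_int(1)[of "\<lambda>w x. score i w * x powr q" n] p1(6) p2(6) by simp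
    qed (use p1(2) p2(2) in \<open>simp add: r\<close>)
    define m where "m n = (LINT w|lborel. r n w)" for n
    define E where "E n = (LINT w|lborel. tsallis_integrand q (r n w) (p0 w))" for n
    define N where "N n = (\<chi> i. LINT w|lborel. score i w * r n w powr q)" for n
    have m_eq: "m = (\<lambda>n. 1 + (LINT w|lborel. indicator (A n) w * fst (G w)))"
      by (rule ext) (use switch_int(2)[of "\<lambda>w x. x"] p1(3,7) p2(3,7) in \<open>simp add: m_def G_def\<close>)
    have "(LINT w|lborel. fst (G w)) = 0"
      using p1(3,7) p2(3,7) by (simp add: G_def)
    \<comment> \<open>The split is approximate, so the switched functions have mass tending to 1
      rather than equal to 1; this is why \<open>?x\<close> is renormalized.\<close>
    hence m: "m \<longlonglongrightarrow> 1"
      unfolding m_eq using tendsto_add[OF tendsto_const pick_lim[OF bounded_linear_fst], of 1] by simp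
    have E_eq: "E = (\<lambda>n. tsallis_div q p2 p0 + (LINT w|lborel. indicator (A n) w * fst (snd (G w))))"
      by (rule ext) (use switch_int(2)[of "\<lambda>w x. tsallis_integrand q x (p0 w)"] p1(5) p2(5)
        tsallis_div_eq_integral[OF p(2)] in \<open>simp add: E_def G_def T_def[abs_def]\<close>)
    have E_diff: "(LINT w|lborel. fst (snd (G w))) = tsallis_div q p1 p0 - tsallis_div q p2 p0"
      using p1(5) p2(5) tsallis_div_eq_integral[OF p(1)] tsallis_div_eq_integral[OF p(2)]
      by (simp add: G_def T_def[abs_def])
    have E: "E \<longlonglongrightarrow> tsallis_div q p2 p0 + t * (tsallis_div q p1 p0 - tsallis_div q p2 p0)"
      unfolding E_eq E_diff[symmetric]
      by (intro tendsto_add tendsto_const pick_lim bounded_linear_fst_comp bounded_linear_snd)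
    have "N \<longlonglongrightarrow> (\<chi> i. margins p2 $ i + t * (margins p1 $ i - margins p2 $ i))"
    proof (rule vec_tendstoI)
      fix i
      have N_eq: "(\<lambda>n. N n $ i) = (\<lambda>n. margins p2 $ i + (LINT w|lborel. indicator (A n) w * snd (snd (G w)) $ i))"
        by (rule ext) (use switch_int(2)[of "\<lambda>w x. score i w * x powr q"] p1(6) p2(6)
          in \<open>simp add: N_def G_def S_def margins_nth\<close>)
      have N_diff: "(LINT w|lborel. snd (snd (G w)) $ i) = margins p1 $ i - margins p2 $ i"
        using p1(6) p2(6) by (simp add: G_def S_def margins_nth)
      have bl: "bounded_linear (\<lambda>x :: real \<times> real \<times> (real ^ 'm). snd (snd x) $ i)"
        by (intro bounded_linear_compose[OF bounded_linear_vec_nth] bounded_linear_snd_comp bounded_linear_snd)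
      show "(\<lambda>n. N n $ i) \<longlonglongrightarrow> (\<chi> i. margins p2 $ i + t * (margins p1 $ i - margins p2 $ i)) $ i"
        unfolding N_eq N_diff[symmetric] vec_lambda_beta
        by (intro tendsto_add tendsto_const pick_lim bl)
    qed
    also have "(\<chi> i. margins p2 $ i + t * (margins p1 $ i - margins p2 $ i)) = t *\<^sub>R margins p1 + (1 - t) *\<^sub>R margins p2"
      by (simp add: vec_eq_iff algebra_simps)
    finally have N: "N \<longlonglongrightarrow> t *\<^sub>R margins p1 + (1 - t) *\<^sub>R margins p2" .
    let ?x = "\<lambda>n. ((1 / m n) powr q * E n - q_ln q (m n), (1 / m n) powr q *\<^sub>R N n)"
    have "?x \<longlonglongrightarrow> ((1 / 1) powr q * (tsallis_div q p2 p0 + t * (tsallis_div q p1 p0 - tsallis_div q p2 p0)) - q_ln q 1,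
        (1 / 1) powr q *\<^sub>R (t *\<^sub>R margins p1 + (1 - t) *\<^sub>R margins p2))"
      by (intro tendsto_intros m E N tendsto_q_ln) auto
    moreover have "\<forall>\<^sub>F n in sequentially. m n > 0"
      using order_tendstoD(1)[OF m, of 0] by simp
    hence "\<forall>\<^sub>F n in sequentially. ?x n \<in> closure attainable"
    proof eventually_elim
      case (elim n)
      have "?x n \<in> attainable"
        unfolding attainable_def
        using normalized_adm[OF rint elim m_def[symmetric]]
        by (auto simp: E_def N_def intro!: exI[of _ "\<lambda>w. 1 / m n * r n w"])
      thus ?case
        by (rule subsetD[OF closure_subset])
    qed
    ultimately have "((1 / 1) powr q * (tsallis_div q p2 p0 + t * (tsallis_div q p1 p0 - tsallis_div q p2 p0)) - q_ln q 1,
        (1 / 1) powr q *\<^sub>R (t *\<^sub>R margins p1 + (1 - t) *\<^sub>R margins p2)) \<in> closure attainable"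
      by (intro Lim_in_closed_set[of "closure attainable" ?x sequentially]) auto
    thus ?thesis
      by (simp add: v1 v2 algebra_simps)
  qed
  \<comment> \<open>Convex combinations of attainable points lie in the closure; sequences of
    attainable points extend this to the whole closure.\<close>
  show ?thesis
    unfolding convex_alt
  proof (intro ballI allI impI)
    fix v1 v2 t
    assume v: "v1 \<in> closure attainable" "v2 \<in> closure attainable" and t: "0 \<le> t \<and> t \<le> (1::real)"
    obtain a b where ab: "\<And>n. a n \<in> attainable" "a \<longlonglongrightarrow> v1" "\<And>n. b n \<in> attainable" "b \<longlonglongrightarrow> v2"
      using v by (auto simp: closure_sequential)
    have "(\<lambda>n. (1 - t) *\<^sub>R a n + t *\<^sub>R b n) \<longlonglongrightarrow> (1 - t) *\<^sub>R v1 + t *\<^sub>R v2"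
      by (intro tendsto_intros ab)
    moreover have "(1 - t) *\<^sub>R a n + t *\<^sub>R b n \<in> closure attainable" for n
      using combo[OF ab(1)[of n] ab(3)[of n], of "1 - t"] t by simp
    ultimately show "(1 - t) *\<^sub>R v1 + t *\<^sub>R v2 \<in> closure attainable"
      by (intro Lim_in_closed_set[of "closure attainable" _ sequentially]) auto
  qed
qed

section \<open>Multipliers from a separating hyperplane\<close>

abbreviation "L \<equiv> lagrangian q q' C p0 y f"

lemma lagrangian_eq:
  "L \<beta> p z = tsallis_div q p p0 + C * (\<Sum>i\<in>UNIV. q_exp q' (- z $ i)) + \<beta> \<bullet> (z - margins p)"
  by (simp add: lagrangian_def primal_objective_def inner_vec_def margins_def)

text \<open>The objective sees a density only through its divergence and margins, so the separation
  takes place in a finite-dimensional space. The multipliers are the slopes of the hyperplane;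
  \<open>\<alpha>\<close> will be the optimal value.\<close>

lemma exists_multiplier:
  assumes \<alpha>: "\<And>p. adm p \<Longrightarrow> \<alpha> \<le> primal_objective q q' C p0 p (margins p)"
  shows "\<exists>\<beta>. \<forall>p z. adm p \<longrightarrow> \<alpha> \<le> L \<beta> p z"
proof (cases "attainable = {}")
  case True
  thus ?thesis by (auto simp: attainable_def)
next
  case False
  define loss where "loss u = C * (\<Sum>i\<in>UNIV. q_exp q' (- u $ i))" for u :: "real ^ 'm"
  define U where "U = {v. fst v + loss (snd v) < \<alpha>}"
  have cont: "continuous_on UNIV (\<lambda>v. fst v + loss (snd v))"
    unfolding loss_def
    by (intro continuous_intros continuous_on_compose2[OF continuous_on_q_exp[OF q', of UNIV]]) auto
  have convex_loss: "loss ((1 - t) *\<^sub>R u + t *\<^sub>R v) \<le> (1 - t) * loss u + t * loss v"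
    if t: "0 \<le> t" "t \<le> 1" for t u v
  proof -
    have "(\<Sum>i\<in>UNIV. q_exp q' (- ((1 - t) *\<^sub>R u + t *\<^sub>R v) $ i))
        \<le> (\<Sum>i\<in>UNIV. (1 - t) * q_exp q' (- u $ i) + t * q_exp q' (- v $ i))"
    proof (rule sum_mono)
      fix i
      show "q_exp q' (- ((1 - t) *\<^sub>R u + t *\<^sub>R v) $ i) \<le> (1 - t) * q_exp q' (- u $ i) + t * q_exp q' (- v $ i)"
        using convex_onD[OF convex_on_q_exp[OF q'], of t "- u $ i" "- v $ i"] t
        by (simp add: algebra_simps)
    qed
    hence "loss ((1 - t) *\<^sub>R u + t *\<^sub>R v)
        \<le> C * (\<Sum>i\<in>UNIV. (1 - t) * q_exp q' (- u $ i) + t * q_exp q' (- v $ i))"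
      unfolding loss_def using C by (intro mult_left_mono) auto
    thus ?thesis
      unfolding loss_def sum.distrib sum_distrib_left[symmetric] distrib_left
      by (simp only: mult.left_commute)
  qed
  have "convex U"
    unfolding convex_alt
  proof (intro ballI allI impI)
    fix v1 v2 t
    assume v: "v1 \<in> U" "v2 \<in> U" and t: "0 \<le> t \<and> t \<le> (1::real)"
    have "loss ((1 - t) *\<^sub>R snd v1 + t *\<^sub>R snd v2) \<le> (1 - t) * loss (snd v1) + t * loss (snd v2)"
      using convex_loss[of t "snd v1" "snd v2"] t by simp
    moreover have "(1 - t) * (fst v1 + loss (snd v1)) + t * (fst v2 + loss (snd v2)) < \<alpha>"
      using v t by (intro convex_bound_lt) (auto simp: U_def)
    ultimately show "(1 - t) *\<^sub>R v1 + t *\<^sub>R v2 \<in> U"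
      by (simp add: U_def algebra_simps)
  qed
  moreover have "(\<alpha> - loss 0 - 1, 0) \<in> U"
    by (simp add: U_def)
  hence "U \<noteq> {}" by blast
  \<comment> \<open>\<open>U\<close> is open, as a strict sublevel set of a continuous function, so
    disjointness passes to the closure.\<close>
  moreover have "closure attainable \<inter> U = {}"
  proof -
    have "open U"
      unfolding U_def by (intro open_Collect_less cont continuous_on_const)
    moreover have "attainable \<inter> U = {}"
      using \<alpha> by (force simp: attainable_def U_def loss_def primal_objective_def)
    ultimately show ?thesis
      using open_Int_closure_eq_empty by blast
  qed
  ultimately obtain a b where a: "a \<noteq> 0" "\<And>v. v \<in> closure attainable \<Longrightarrow> a \<bullet> v \<le> b" "\<And>v. v \<in> U \<Longrightarrow> b \<le> a \<bullet> v"
    using separating_hyperplane_sets[OF convex_closure_attainable, of U] False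
    unfolding closure_eq_empty by blast
  obtain a0 a1 where a01: "a = (a0, a1)" by (cases a)
  have sepU: "b \<le> a0 * t + a1 \<bullet> u" if "t + loss u < \<alpha>" for t u
    using a(3)[of "(t, u)"] that by (simp add: a01 U_def)
  have sepV: "a0 * tsallis_div q p p0 + a1 \<bullet> margins p \<le> b" if "adm p" for p
    using a(2)[of "(tsallis_div q p p0, margins p)"] that subsetD[OF closure_subset, of _ attainable]
    by (auto simp: a01 attainable_def)
  \<comment> \<open>A positive \<open>a0\<close> fails because \<open>U\<close> extends downwards
    without bound. With \<open>a0 = 0\<close> the form \<open>a1 \<bullet> u\<close> would be
    bounded below in \<open>u\<close>, since \<open>U\<close> has points over every
    \<open>u\<close>.\<close>
  have "a0 < 0"
  proof (rule ccontr)
    assume "\<not> a0 < 0"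
    moreover have "\<not> a0 > 0"
    proof
      assume pos: "a0 > 0"
      define t where "t = min (\<alpha> - loss 0 - 1) ((b - 1) / a0)"
      have "a0 * t \<le> b - 1"
        using pos by (simp add: t_def min_def field_simps)
      moreover have "b \<le> a0 * t"
        using sepU[of t 0] by (simp add: t_def)
      ultimately show False by simp
    qed
    ultimately have 0: "a0 = 0" by simp
    hence "a1 \<noteq> 0" using a(1) by (simp add: a01 zero_prod_def)
    define u where "u = ((b - 1) / (a1 \<bullet> a1)) *\<^sub>R a1"
    have "a1 \<bullet> u = b - 1"
      using \<open>a1 \<noteq> 0\<close> by (simp add: u_def)
    moreover have "b \<le> a1 \<bullet> u"
      using sepU[of "\<alpha> - loss u - 1" u] 0 by simp
    ultimately show False by simp
  qed
  define \<beta> where "\<beta> = (1 / (- a0)) *\<^sub>R a1"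
  have \<beta>: "a1 = (- a0) *\<^sub>R \<beta>"
    using \<open>a0 < 0\<close> by (simp add: \<beta>_def)
  have "\<alpha> \<le> L \<beta> p z" if p: "adm p" for p z
  proof (rule field_le_epsilon)
    fix e :: real assume e: "e > 0"
    \<comment> \<open>The pair belonging to \<open>p\<close> is compared with the point of
      \<open>U\<close> lying \<open>e\<close> below the boundary over \<open>z\<close>.\<close>
    have "a0 * tsallis_div q p p0 + a1 \<bullet> margins p \<le> a0 * (\<alpha> - loss z - e) + a1 \<bullet> z"
      using sepV[OF p] sepU[of "\<alpha> - loss z - e" z] e by simp
    hence "(- a0) * (\<alpha> - loss z - e - tsallis_div q p p0) \<le> (- a0) * (\<beta> \<bullet> z - \<beta> \<bullet> margins p)"
      by (simp add: \<beta> algebra_simps)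
    hence "\<alpha> - loss z - e - tsallis_div q p p0 \<le> \<beta> \<bullet> z - \<beta> \<bullet> margins p"
      using \<open>a0 < 0\<close> by (subst (asm) mult_le_cancel_left_pos) auto
    thus "\<alpha> \<le> L \<beta> p z + e"
      by (simp add: lagrangian_eq loss_def inner_diff_right)
  qed
  thus ?thesis by blast
qed

section \<open>Minimization over the density for fixed multipliers\<close>

abbreviation "H \<equiv> label_feature_matrix y f"

abbreviation "expo \<equiv> q_exponent q p0 H"

definition "linear_score \<beta> w = \<beta> \<bullet> (H *v w)"

text \<open>The base of the power in the q-exponential before truncation. It is 1 if
  \<open>q = 1\<close> and wherever the prior vanishes, so its sign matters only where the prior is
  positive.\<close>

definition "base \<beta> w = 1 + (1 - q) * expo \<beta> w"

text \<open>Real-valued, hence 0 instead of infinity where \<open>q > 1\<close> and the base is not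
  positive; it represents the integrand of the normalizer only where the base is positive.\<close>

definition "tilted \<beta> w = p0 w * q_exp q (expo \<beta> w)"

abbreviation "Z \<equiv> q_normalizer q p0 H"

definition "inner_lagrangian \<beta> p = tsallis_div q p p0 - \<beta> \<bullet> margins p"

lemma expo_eq: "expo \<beta> w = p0 w powr (q - 1) * linear_score \<beta> w"
  by (simp add: q_exponent_def linear_score_def)

lemma linear_score_eq: "linear_score \<beta> w = (\<Sum>i\<in>UNIV. \<beta> $ i * score i w)"
  by (simp add: linear_score_def inner_vec_def score_def label_feature_matrix_def
      matrix_vector_mult_def sum_distrib_left mult.assoc)

lemma linear_score_measurable [measurable]: "linear_score \<beta> \<in> borel_measurable borel"
  unfolding linear_score_eq[abs_def] by measurable

lemma expo_measurable [measurable]: "expo \<beta> \<in> borel_measurable borel"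
  unfolding expo_eq[abs_def] by measurable

lemma base_measurable [measurable]: "base \<beta> \<in> borel_measurable borel"
  unfolding base_def[abs_def] by measurable

lemma tilted_measurable [measurable]: "tilted \<beta> \<in> borel_measurable borel"
  unfolding tilted_def[abs_def] by (intro borel_measurable_times borel_measurable_q_exp) measurable

lemma base_pos_if_p0_zero: "p0 w = 0 \<Longrightarrow> base \<beta> w = 1"
  by (simp add: base_def expo_eq)

lemma base_q_one: "q = 1 \<Longrightarrow> base \<beta> w = 1"
  unfolding base_def by simp

lemma q_exp_ext_eq: "0 < base \<beta> w \<Longrightarrow> q_exp_ext q (expo \<beta> w) = ennreal (q_exp q (expo \<beta> w))"
  by (simp add: q_exp_ext_def base_def)

lemma q_exp_ext_infinite: "base \<beta> w \<le> 0 \<Longrightarrow> q_exp_ext q (expo \<beta> w) = \<infinity>"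
  unfolding base_def using q by (cases "q = 1") (auto simp: q_exp_ext_def)

lemma base_pos_iff: "q_exp_ext q (expo \<beta> w) < \<infinity> \<longleftrightarrow> 0 < base \<beta> w"
  using q_exp_ext_eq[of \<beta> w] q_exp_ext_infinite[of \<beta> w] by (cases "0 < base \<beta> w") auto

lemma q_exp_ext_measurable [measurable]: "(\<lambda>w. q_exp_ext q (expo \<beta> w)) \<in> borel_measurable borel"
  by (intro borel_measurable_q_exp_ext) measurable

lemma q_exp_expo_pos: "0 < base \<beta> w \<Longrightarrow> 0 < q_exp q (expo \<beta> w)"
  using q_exp_pos[of q "expo \<beta> w"] by (simp add: base_def)

lemma tilted_nonneg: "0 \<le> tilted \<beta> w"
  by (simp add: tilted_def p0_nonneg q_exp_nonneg)

lemma normalizer_integrand: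
  "0 < base \<beta> w \<Longrightarrow> ennreal (p0 w) * q_exp_ext q (expo \<beta> w) = ennreal (tilted \<beta> w)"
  by (simp add: q_exp_ext_eq tilted_def p0_nonneg ennreal_mult')

lemma not_AE_p0_zero: "\<not> (AE w in lborel. p0 w = 0)"
proof
  assume "AE w in lborel. p0 w = 0"
  hence "(LINT w|lborel. p0 w) = 0"
    by (rule integral_eq_zero_AE)
  thus False using p0_integral by simp
qed

lemma normalizer_pos: "0 < Z \<beta>"
proof (rule ccontr)
  assume "\<not> 0 < Z \<beta>"
  hence "(\<integral>\<^sup>+ w. ennreal (p0 w) * q_exp_ext q (expo \<beta> w) \<partial>lborel) = 0"
    by (simp add: q_normalizer_def)
  hence "AE w in lborel. ennreal (p0 w) * q_exp_ext q (expo \<beta> w) = 0"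
    by (subst (asm) nn_integral_0_iff_AE) auto
  hence "AE w in lborel. p0 w = 0"
  proof eventually_elim
    case (elim w)
    show ?case
    proof (cases "0 < base \<beta> w")
      case True
      thus ?thesis using elim q_exp_expo_pos[OF True] p0_nonneg[of w] by (auto simp: q_exp_ext_eq)
    next
      case False
      thus ?thesis using elim q_exp_ext_infinite[of \<beta> w] p0_nonneg[of w] by auto
    qed
  qed
  thus False using not_AE_p0_zero by simp
qed

text \<open>Where the base is not positive, the prior is positive and the integrand of the
  normalizer is infinite; a finite integral permits this only on a null set.\<close>

lemma AE_base_pos:
  assumes "Z \<beta> < \<infinity>"
  shows "AE w in lborel. 0 < base \<beta> w"
proof -
  have "AE w in lborel. ennreal (p0 w) * q_exp_ext q (expo \<beta> w) \<noteq> \<infinity>"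
    using assms by (intro nn_integral_PInf_AE) (auto simp: q_normalizer_def)
  thus ?thesis
  proof eventually_elim
    case (elim w)
    show ?case
    proof (rule ccontr)
      assume *: "\<not> 0 < base \<beta> w"
      hence "p0 w > 0"
        using base_pos_if_p0_zero[of w \<beta>] p0_nonneg[of w] by force
      thus False
        using elim q_exp_ext_infinite[of \<beta> w] * by (auto simp: ennreal_mult_top)
    qed
  qed
qed

lemma normalizer_eq:
  assumes "AE w in lborel. 0 < base \<beta> w"
  shows "Z \<beta> = (\<integral>\<^sup>+ w. ennreal (tilted \<beta> w) \<partial>lborel)"
  unfolding q_normalizer_def using assms
  by (intro nn_integral_cong_AE) (auto elim!: eventually_mono simp: normalizer_integrand)

lemma inner_lagrangian_integral:
  assumes "adm p"
  shows "integrable lborel (\<lambda>w. tsallis_integrand q (p w) (p0 w) - linear_score \<beta> w * p w powr q)"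
    and "inner_lagrangian \<beta> p = (LINT w|lborel. tsallis_integrand q (p w) (p0 w) - linear_score \<beta> w * p w powr q)"
proof -
  have p: "integrable lborel (\<lambda>w. tsallis_integrand q (p w) (p0 w))"
    "\<And>i. integrable lborel (\<lambda>w. score i w * p w powr q)"
    using assms by (auto simp: adm_iff integrands_integrable_def)
  have eq: "linear_score \<beta> w * p w powr q = (\<Sum>i\<in>UNIV. \<beta> $ i * (score i w * p w powr q))" for w
    by (simp add: linear_score_eq sum_distrib_right mult.assoc)
  have int: "integrable lborel (\<lambda>w. linear_score \<beta> w * p w powr q)"
    unfolding eq using p(2) by (intro Bochner_Integration.integrable_sum integrable_mult_right)
  have "(LINT w|lborel. linear_score \<beta> w * p w powr q) = \<beta> \<bullet> margins p"
    unfolding eq using p(2) by (subst Bochner_Integration.integral_sum) (auto simp: inner_vec_def margins_nth)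
  thus "inner_lagrangian \<beta> p = (LINT w|lborel. tsallis_integrand q (p w) (p0 w) - linear_score \<beta> w * p w powr q)"
    using p(1) int by (simp add: inner_lagrangian_def tsallis_div_eq_integral[OF assms])
  show "integrable lborel (\<lambda>w. tsallis_integrand q (p w) (p0 w) - linear_score \<beta> w * p w powr q)"
    using p(1) int by simp
qed

lemma inner_integrand_tilted:
  assumes "a \<ge> 0" "p0 w = 0 \<longrightarrow> a = 0" "0 < base \<beta> w"
  shows "tsallis_integrand q a (p0 w) - linear_score \<beta> w * a powr q = tsallis_integrand q a (tilted \<beta> w)"
proof (cases "p0 w = 0")
  case False
  thus ?thesis
    using tsallis_integrand_tilt[of a "p0 w" q "linear_score \<beta> w"] assms p0_nonneg[of w]
    by (simp add: base_def tilted_def expo_eq)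
qed (use assms in simp)

lemma inner_integrand_base:
  assumes "a \<ge> 0" "p0 w = 0 \<longrightarrow> a = 0" "q \<noteq> 1"
  shows "tsallis_integrand q a (p0 w) - linear_score \<beta> w * a powr q
    = (a powr q * p0 w powr (1 - q) * base \<beta> w - a) / (q - 1)"
proof (cases "p0 w = 0")
  case False
  thus ?thesis
    using tsallis_integrand_tilt_neq_one[of a "p0 w" q "linear_score \<beta> w"] assms p0_nonneg[of w]
    by (simp add: base_def expo_eq)
qed (use assms in simp)

lemma adm_props:
  assumes "adm p"
  shows "p \<in> borel_measurable borel" "\<And>w. 0 \<le> p w" "integrable lborel p" "(LINT w|lborel. p w) = 1"
    "AE w in lborel. p0 w = 0 \<longrightarrow> p w = 0"
  using assms by (auto simp: adm_iff integrands_integrable_def)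

lemma tilted_integral:
  assumes "Z \<beta> < \<infinity>"
  shows "integrable lborel (tilted \<beta>)" "(LINT w|lborel. tilted \<beta> w) = enn2real (Z \<beta>)" "0 < enn2real (Z \<beta>)"
proof -
  have Z: "Z \<beta> = (\<integral>\<^sup>+ w. ennreal (tilted \<beta> w) \<partial>lborel)"
    using normalizer_eq[OF AE_base_pos[OF assms]] .
  show "integrable lborel (tilted \<beta>)"
    using assms Z tilted_nonneg by (intro integrableI_nonneg) auto
  show "(LINT w|lborel. tilted \<beta> w) = enn2real (Z \<beta>)"
    using tilted_nonneg Z by (simp add: integral_eq_nn_integral)
  show "0 < enn2real (Z \<beta>)"
    using normalizer_pos[of \<beta>] assms by (simp add: enn2real_positive_iff)
qed

text \<open>A deformed Gibbs variational principle: integrate the affine minorant with reference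
  \<open>tilted \<beta>\<close>, whose mass is \<open>Z \<beta>\<close>. In the equality case the
  gap is nonnegative with integral 0, so contact holds almost everywhere.\<close>

lemma gibbs:
  assumes fin: "Z \<beta> < \<infinity>" and p: "adm p"
  shows "- q_ln q (enn2real (Z \<beta>)) \<le> inner_lagrangian \<beta> p" (is ?le)
    and "inner_lagrangian \<beta> p = - q_ln q (enn2real (Z \<beta>)) \<Longrightarrow>
      AE w in lborel. p w = tilted \<beta> w / enn2real (Z \<beta>)"
proof -
  note P = adm_props[OF p] and T = tilted_integral[OF fin]
  define z where "z = enn2real (Z \<beta>)"
  have z: "z > 0" using T by (simp add: z_def)
  define tangent where "tangent w = - (p w * q_ln q z) - z powr (1 - q) * (tilted \<beta> w / z - p w)" for w
  define J where "J w = tsallis_integrand q (p w) (p0 w) - linear_score \<beta> w * p w powr q" for w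
  have J: "integrable lborel J" "inner_lagrangian \<beta> p = (LINT w|lborel. J w)"
    unfolding J_def using inner_lagrangian_integral[OF p] by auto
  have tangent: "integrable lborel tangent"
    unfolding tangent_def using P T by (intro Bochner_Integration.integrable_diff integrable_minus integrable_mult_right integrable_mult_left integrable_divide) auto
  have tangent_int: "(LINT w|lborel. tangent w) = - q_ln q z"
  proof -
    have "(LINT w|lborel. tangent w) = - (1 * q_ln q z) - z powr (1 - q) * (z / z - 1)"
      unfolding tangent_def using P T by (simp add: z_def)
    thus ?thesis using z by simp
  qed
  have AE: "AE w in lborel. tangent w \<le> J w \<and> (tangent w = J w \<longrightarrow> p w = tilted \<beta> w / z)"
    using P(5) AE_base_pos[OF fin]
  proof eventually_elim
    case (elim w)
    show ?case
    proof (cases "p0 w = 0")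
      case True
      thus ?thesis using elim by (simp add: tangent_def J_def tilted_def)
    next
      case False
      hence "tilted \<beta> w > 0"
        using q_exp_expo_pos[of \<beta> w] elim p0_nonneg[of w] by (simp add: tilted_def)
      moreover have "J w = tsallis_integrand q (p w) (tilted \<beta> w)"
        unfolding J_def using elim P(2) by (intro inner_integrand_tilted) auto
      ultimately show ?thesis
        using tsallis_integrand_tangent[OF q P(2)[of w] _ z] by (auto simp: tangent_def)
    qed
  qed
  have "(LINT w|lborel. tangent w) \<le> (LINT w|lborel. J w)"
    using J tangent AE by (intro integral_mono_AE) (auto elim: eventually_mono)
  thus ?le
    by (simp add: J tangent_int flip: z_def)
  assume "inner_lagrangian \<beta> p = - q_ln q (enn2real (Z \<beta>))"
  hence "(LINT w|lborel. J w - tangent w) = 0"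
    using J tangent tangent_int by (simp add: z_def)
  hence "AE w in lborel. J w - tangent w = 0"
    using J tangent AE by (subst (asm) integral_nonneg_eq_0_iff_AE) (auto elim: eventually_mono)
  thus "AE w in lborel. p w = tilted \<beta> w / enn2real (Z \<beta>)"
    using AE unfolding z_def by eventually_elim auto
qed

text \<open>Valid for either sign of the base, unlike the form with \<open>tilted\<close>; the -1 is
  the mass of \<open>p\<close>.\<close>

lemma inner_lagrangian_base:
  assumes p: "adm p" and "q \<noteq> 1"
  shows "integrable lborel (\<lambda>w. p w powr q * p0 w powr (1 - q) * base \<beta> w)"
    and "inner_lagrangian \<beta> p = ((LINT w|lborel. p w powr q * p0 w powr (1 - q) * base \<beta> w) - 1) / (q - 1)"
proof -
  note P = adm_props[OF p]
  note [measurable] = P(1)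
  define J where "J w = tsallis_integrand q (p w) (p0 w) - linear_score \<beta> w * p w powr q" for w
  have J: "integrable lborel J" "inner_lagrangian \<beta> p = (LINT w|lborel. J w)"
    unfolding J_def using inner_lagrangian_integral[OF p] by auto
  have AE: "AE w in lborel. (q - 1) * J w + p w = p w powr q * p0 w powr (1 - q) * base \<beta> w"
    using P(5)
  proof eventually_elim
    case (elim w)
    thus ?case
      using inner_integrand_base[of "p w" w \<beta>] P(2)[of w] \<open>q \<noteq> 1\<close> by (simp add: J_def)
  qed
  have int: "integrable lborel (\<lambda>w. (q - 1) * J w + p w)"
    using J P by auto
  show "integrable lborel (\<lambda>w. p w powr q * p0 w powr (1 - q) * base \<beta> w)"
    by (rule integrable_cong_AE_imp[OF int]) (use AE in \<open>auto elim: eventually_mono\<close>)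
  have "(LINT w|lborel. p w powr q * p0 w powr (1 - q) * base \<beta> w) = (LINT w|lborel. (q - 1) * J w + p w)"
    by (rule integral_cong_AE) (use AE J in \<open>auto elim: eventually_mono\<close>)
  also have "\<dots> = (q - 1) * inner_lagrangian \<beta> p + 1"
    using J P by simp
  finally show "inner_lagrangian \<beta> p = ((LINT w|lborel. p w powr q * p0 w powr (1 - q) * base \<beta> w) - 1) / (q - 1)"
    using \<open>q \<noteq> 1\<close> by simp
qed

text \<open>A nonnegative base makes the integral in \<open>inner_lagrangian_base\<close>
  nonnegative. With a positive base that integral vanishes only for \<open>p = 0\<close> almost
  everywhere, so the bound is not attained; this later rules out an infinite normalizer at a
  solution.\<close>

lemma gibbs_infinite:
  assumes base: "AE w in lborel. 0 \<le> base \<beta> w" and p: "adm p" and "q > 1"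
  shows "- (1 / (q - 1)) \<le> inner_lagrangian \<beta> p" (is ?le)
    and "AE w in lborel. 0 < base \<beta> w \<Longrightarrow> inner_lagrangian \<beta> p \<noteq> - (1 / (q - 1))"
proof -
  define I where "I w = p w powr q * p0 w powr (1 - q) * base \<beta> w" for w
  have I: "integrable lborel I" "inner_lagrangian \<beta> p = ((LINT w|lborel. I w) - 1) / (q - 1)"
    unfolding I_def using inner_lagrangian_base[OF p] \<open>q > 1\<close> by auto
  have I0: "AE w in lborel. 0 \<le> I w"
    using base by (auto simp: I_def elim: eventually_mono)
  hence "0 \<le> (LINT w|lborel. I w)"
    by (rule integral_nonneg_AE)
  thus ?le
    using \<open>q > 1\<close> by (simp add: I divide_simps)
  assume pos: "AE w in lborel. 0 < base \<beta> w"
  show "inner_lagrangian \<beta> p \<noteq> - (1 / (q - 1))"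
  proof
    assume "inner_lagrangian \<beta> p = - (1 / (q - 1))"
    hence "(LINT w|lborel. I w) = 0"
      using \<open>q > 1\<close> by (simp add: I divide_simps)
    hence "AE w in lborel. I w = 0"
      using I I0 by (simp add: integral_nonneg_eq_0_iff_AE)
    hence "AE w in lborel. p w = 0"
      using pos adm_props(5)[OF p] by eventually_elim (auto simp: I_def)
    hence "(LINT w|lborel. p w) = 0"
      by (rule integral_eq_zero_AE)
    thus False using adm_props(4)[OF p] by simp
  qed
qed

section \<open>Explicit test densities\<close>

definition "core n = {w. norm w \<le> n \<and> 1 / n \<le> p0 w \<and> p0 w \<le> n}"

lemma core_measurable [measurable]: "core n \<in> sets borel"
  unfolding core_def by measurable

lemma core_bounded: "bounded (core n)"
  by (rule boundedI[of _ n]) (auto simp: core_def)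

lemma core_mono: "0 < m \<Longrightarrow> m \<le> n \<Longrightarrow> core m \<subseteq> core n"
  unfolding core_def using frac_le[of 1 1 m n] by fastforce

lemma in_core_eventually:
  assumes "p0 w > 0"
  shows "\<forall>\<^sub>F n in sequentially. w \<in> core (real (Suc n))"
proof -
  obtain N where N: "max (norm w) (max (1 / p0 w) (p0 w)) \<le> real N"
    using real_arch_simple by blast
  have "w \<in> core (real (Suc n))" if "n \<ge> N" for n
  proof -
    have n: "norm w \<le> real (Suc n)" "1 / p0 w \<le> real (Suc n)" "p0 w \<le> real (Suc n)"
      using N that by auto
    thus ?thesis
      using assms by (auto simp: core_def field_simps)
  qed
  thus ?thesis
    by (auto simp: eventually_sequentially)
qed

text \<open>On \<open>core n\<close> the prior, its reciprocal and the scores are bounded and the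
  measure is finite, so every integrand is bounded with support of finite measure.\<close>

lemma bounded_integrands_integrable:
  assumes [measurable]: "p \<in> borel_measurable borel" and p: "\<And>w. 0 \<le> p w" "\<And>w. p w \<le> M"
    and supp: "\<And>w. w \<notin> core n \<Longrightarrow> p w = 0" and n: "n > 0"
  shows "integrands_integrable p"
proof -
  have fin: "emeasure lborel (core n) < \<infinity>"
    using core_bounded by (rule emeasure_bounded_finite)
  have integrable: "integrable lborel g"
    if [measurable]: "g \<in> borel_measurable borel" and "\<And>w. w \<in> core n \<Longrightarrow> norm (g w) \<le> B"
      and "\<And>w. w \<notin> core n \<Longrightarrow> g w = 0" for g :: "_ \<Rightarrow> real" and B
    by (rule integrableI_bounded_set[of "core n" _ _ B]) (use that fin in auto)
  have M: "0 \<le> M" using p[of 0] by linarith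
  show ?thesis
    unfolding integrands_integrable_def
  proof (intro conjI allI)
    show "integrable lborel p"
      using p supp by (intro integrable[of _ M]) auto
    show "AE w in lborel. p0 w = 0 \<longrightarrow> p w = 0"
    proof (intro AE_I2 impI)
      fix w assume "p0 w = 0"
      hence "w \<notin> core n" using n by (simp add: core_def)
      thus "p w = 0" by (rule supp)
    qed
    show "integrable lborel (\<lambda>w. tsallis_integrand q (p w) (p0 w))"
      using tsallis_integrand_bound[OF q p] n supp
      by (intro integrable[of _ "n + M * (M * n) powr q"]) (auto simp: core_def)
    show "integrable lborel (\<lambda>w. score i w * p w powr q)" for i
    proof (rule integrable[of _ "\<bar>y i\<bar> * (norm (f i) * n) * M powr q"])
      fix w assume w: "w \<in> core n"
      have "\<bar>f i \<bullet> w\<bar> \<le> norm (f i) * norm w"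
        by (rule Cauchy_Schwarz_ineq2)
      also have "\<dots> \<le> norm (f i) * n"
        using w by (intro mult_left_mono) (auto simp: core_def)
      finally show "norm (score i w * p w powr q) \<le> \<bar>y i\<bar> * (norm (f i) * n) * M powr q"
        unfolding score_def real_norm_def abs_mult
        using p q n by (intro mult_mono powr_mono2) (auto intro!: powr_mono2)
    qed (use supp in auto)
  qed (use p in auto)
qed

lemma uniform_adm:
  assumes [measurable]: "B \<in> sets borel" and B: "B \<subseteq> core n" "n > 0" "measure lborel B > 0"
  shows "adm (\<lambda>w. 1 / measure lborel B * indicator B w)"
proof (rule normalized_adm(1))
  show "integrands_integrable (indicator B)"
    using B by (intro bounded_integrands_integrable[of _ 1 n]) (auto simp: indicator_def)
qed (use B in auto)

text \<open>The cores exhaust the set where the prior is positive, so one of them has positive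
  measure and carries a uniform density.\<close>

lemma exists_adm: "\<exists>p. adm p"
proof -
  have "\<exists>n. 0 < measure lborel (core (real (Suc n)))"
  proof (rule exists_positive_piece)
    show "\<not> (AE w in lborel. w \<notin> (\<Union>n. core (real (Suc n))))"
    proof
      assume "AE w in lborel. w \<notin> (\<Union>n. core (real (Suc n)))"
      hence "AE w in lborel. p0 w = 0"
      proof eventually_elim
        case (elim w)
        thus ?case
          using in_core_eventually[of w] p0_nonneg[of w] by (fastforce simp: eventually_sequentially)
      qed
      thus False using not_AE_p0_zero by simp
    qed
  qed (auto intro: core_bounded)
  thus ?thesis
    using uniform_adm[of "core (real (Suc _))" "real (Suc _)"] by fastforce
qed

text \<open>The \<open>q\<close>-th power of a uniform density on \<open>B\<close> has integral
  \<open>measure lborel B powr (1 - q)\<close>, which blows up as \<open>B\<close> shrinks. The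
  number \<open>c\<close> passes on the sign of the base on \<open>B\<close>.\<close>

lemma inner_lagrangian_uniform:
  assumes [measurable]: "B \<in> sets borel" and B: "B \<subseteq> core n" "n > 0" "measure lborel B > 0" and "q > 1"
    and bound: "\<And>w. w \<in> B \<Longrightarrow> p0 w powr (1 - q) * base \<beta> w \<le> c"
  shows "inner_lagrangian \<beta> (\<lambda>w. 1 / measure lborel B * indicator B w)
    \<le> (c * measure lborel B powr (1 - q) - 1) / (q - 1)"
proof -
  define b where "b = measure lborel B"
  have b: "b > 0" using B by (simp add: b_def)
  let ?p = "\<lambda>w. 1 / b * indicator B w"
  have adm: "adm ?p"
    unfolding b_def using B by (intro uniform_adm) auto
  note inner = inner_lagrangian_base[OF adm, of \<beta>]
  have fin: "emeasure lborel B < \<infinity>"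
    using B(1) core_bounded bounded_subset by (intro emeasure_bounded_finite) blast
  have "(LINT w|lborel. ?p w powr q * p0 w powr (1 - q) * base \<beta> w)
      \<le> (LINT w|lborel. (1 / b) powr q * c * indicator B w)"
  proof (rule integral_mono)
    show "integrable lborel (\<lambda>w. ?p w powr q * p0 w powr (1 - q) * base \<beta> w)"
      using inner(1) \<open>q > 1\<close> by simp
    show "integrable lborel (\<lambda>w. (1 / b) powr q * c * indicator B w)"
      using fin by simp
    fix w
    have "(1 / b) powr q * (p0 w powr (1 - q) * base \<beta> w) \<le> (1 / b) powr q * c" if "w \<in> B"
      using bound[OF that] by (intro mult_left_mono) auto
    thus "?p w powr q * p0 w powr (1 - q) * base \<beta> w \<le> (1 / b) powr q * c * indicator B w"
      using \<open>q > 1\<close> by (auto simp: indicator_def mult.assoc)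
  qed
  also have "\<dots> = c * ((1 / b) powr q * b)"
    using fin by (simp add: b_def)
  also have "(1 / b) powr q * b = b powr (1 - q)"
    using b by (simp add: powr_diff powr_divide)
  finally show ?thesis
    using inner(2) \<open>q > 1\<close> by (simp add: b_def divide_right_mono)
qed

text \<open>On a set where the base is bounded above by a negative number, uniform densities on
  subsets of measure \<open>s / (k + 1)\<close> produce a negative term of order
  \<open>(k + 1) powr (q - 1)\<close>.\<close>

lemma inner_lagrangian_unbounded:
  assumes neg: "\<not> (AE w in lborel. 0 \<le> base \<beta> w)"
  shows "\<exists>p. adm p \<and> inner_lagrangian \<beta> p < c"
proof -
  have "q > 1"
  proof (rule ccontr)
    assume "\<not> q > 1"
    hence "base \<beta> w = 1" for w using q base_q_one[of \<beta> w] by simp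
    thus False using neg by simp
  qed
  define S where "S n = {w \<in> core (real (Suc n)). base \<beta> w \<le> - (1 / real (Suc n))}" for n
  have S [measurable]: "S n \<in> sets borel" for n
    unfolding S_def by measurable
  have "\<exists>n. 0 < measure lborel (S n)"
  proof (rule exists_positive_piece)
    show "\<not> (AE w in lborel. w \<notin> (\<Union>n. S n))"
    proof
      assume "AE w in lborel. w \<notin> (\<Union>n. S n)"
      hence "AE w in lborel. 0 \<le> base \<beta> w"
      proof eventually_elim
        case (elim w)
        show ?case
        proof (rule ccontr)
          assume b: "\<not> 0 \<le> base \<beta> w"
          hence "p0 w > 0"
            using base_pos_if_p0_zero[of w \<beta>] p0_nonneg[of w] by force
          hence "\<forall>\<^sub>F n in sequentially. w \<in> core (real (Suc n))"
            by (rule in_core_eventually)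
          moreover have "\<forall>\<^sub>F n in sequentially. 1 / real (Suc n) < - base \<beta> w"
            using b by (intro order_tendstoD[OF LIMSEQ_Suc[OF lim_1_over_n]]) simp
          ultimately have "\<forall>\<^sub>F n in sequentially. w \<in> S n"
            by eventually_elim (auto simp: S_def)
          thus False using elim by (auto simp: eventually_sequentially)
        qed
      qed
      thus False using neg by simp
    qed
    show "bounded (S n)" for n
      by (rule bounded_subset[OF core_bounded[of "real (Suc n)"]]) (auto simp: S_def)
  qed simp
  then obtain n where n: "0 < measure lborel (S n)" by blast
  define s where "s = measure lborel (S n)"
  define N where "N = real (Suc n)"
  have N: "N > 0" by (simp add: N_def)
  have sub: "S n \<subseteq> core N" by (auto simp: S_def N_def)
  have fin: "emeasure lborel (S n) < \<infinity>"
    using bounded_subset[OF core_bounded sub] by (rule emeasure_bounded_finite)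
  have "\<exists>A\<in>sets borel. A \<subseteq> S n \<and> measure lborel A = 1 / real (Suc k) * s" for k
    unfolding s_def by (rule lborel_split_set) (use fin in auto)
  then obtain A where A: "\<And>k. A k \<in> sets borel" "\<And>k. A k \<subseteq> S n"
      "\<And>k. measure lborel (A k) = 1 / real (Suc k) * s"
    by metis
  \<comment> \<open>Lower bound for \<open>p0 w powr (1 - q) * (- base \<beta> w)\<close> on
    \<open>S n\<close>: the prior is at most \<open>N\<close> and the exponent \<open>1 - q\<close>
    is negative.\<close>
  define d where "d = N powr (1 - q) * (1 / N)"
  have d: "d > 0" using N by (simp add: d_def)
  have bound: "p0 w powr (1 - q) * base \<beta> w \<le> - d" if "w \<in> S n" for w
  proof -
    have w: "1 / N \<le> p0 w" "p0 w \<le> N" "1 / N \<le> - base \<beta> w"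
      using that by (auto simp: S_def N_def core_def)
    have "0 < p0 w"
      using w N by (meson divide_pos_pos less_le_trans zero_less_one)
    hence "N powr (1 - q) \<le> p0 w powr (1 - q)"
      using w \<open>q > 1\<close> by (intro powr_mono2') auto
    hence "d \<le> p0 w powr (1 - q) * (- base \<beta> w)"
      unfolding d_def using w N by (intro mult_mono) auto
    thus ?thesis by simp
  qed
  define a where "a k = 1 / real (Suc k) * s" for k
  have a: "a k > 0" for k using n by (simp add: a_def s_def)
  have le: "inner_lagrangian \<beta> (\<lambda>w. 1 / measure lborel (A k) * indicator (A k) w)
      \<le> (- d * a k powr (1 - q) - 1) / (q - 1)" for k
    using inner_lagrangian_uniform[of "A k" N \<beta> "- d"] A[of k] sub N a[of k] bound \<open>q > 1\<close>
    by (auto simp: a_def)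
  have a_eq: "a k powr (1 - q) = real (Suc k) powr (q - 1) * s powr (1 - q)" for k
    using n by (simp add: a_def s_def powr_divide powr_minus_divide[of _ "1 - q", simplified])
  \<comment> \<open>The threshold that \<open>real (Suc k) powr (q - 1)\<close> has to exceed for
    the bound \<open>le\<close> to drop below \<open>c\<close>.\<close>
  define X where "X = (\<bar>c\<bar> * (q - 1) + 1) / (d * s powr (1 - q))"
  have X: "X > 0"
    unfolding X_def using d n \<open>q > 1\<close> by (intro divide_pos_pos add_nonneg_pos mult_pos_pos) (auto simp: s_def)
  obtain k where "X powr (1 / (q - 1)) < real k"
    using reals_Archimedean2 by blast
  hence "(X powr (1 / (q - 1))) powr (q - 1) < real (Suc k) powr (q - 1)"
    using \<open>q > 1\<close> by (intro powr_less_mono2) auto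
  hence "X < real (Suc k) powr (q - 1)"
    using \<open>q > 1\<close> X by (simp add: powr_powr)
  hence "\<bar>c\<bar> * (q - 1) + 1 < d * a k powr (1 - q)"
    using d n by (simp add: X_def pos_divide_less_eq a_eq mult_ac s_def)
  hence "- d * a k powr (1 - q) - 1 < c * (q - 1)"
    using \<open>q > 1\<close> mult_right_mono[of "- \<bar>c\<bar>" c "q - 1"] by (simp add: abs_ge_minus_self) linarith
  hence "(- d * a k powr (1 - q) - 1) / (q - 1) < c"
    using \<open>q > 1\<close> by (simp add: pos_divide_less_eq)
  moreover have "adm (\<lambda>w. 1 / measure lborel (A k) * indicator (A k) w)"
    using uniform_adm[of "A k" N] A[of k] sub N a[of k] by (auto simp: a_def)
  ultimately show ?thesis
    using le[of k] by (intro exI[of _ "\<lambda>w. 1 / measure lborel (A k) * indicator (A k) w"]) auto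
qed

text \<open>A uniform density on a bounded piece of the set where the base is not positive: the case
  \<open>c = 0\<close> of \<open>inner_lagrangian_uniform\<close>.\<close>

lemma inner_lagrangian_degenerate:
  assumes nonpos: "\<not> (AE w in lborel. 0 < base \<beta> w)"
  shows "q > 1" "\<exists>p. adm p \<and> inner_lagrangian \<beta> p \<le> - (1 / (q - 1))"
proof -
  show "q > 1"
  proof (rule ccontr)
    assume "\<not> q > 1"
    hence "base \<beta> w = 1" for w using q base_q_one[of \<beta> w] by simp
    thus False using nonpos by simp
  qed
  define S where "S n = {w \<in> core (real (Suc n)). base \<beta> w \<le> 0}" for n
  have S [measurable]: "S n \<in> sets borel" for n
    unfolding S_def by measurable
  have "\<exists>n. 0 < measure lborel (S n)"
  proof (rule exists_positive_piece)
    show "\<not> (AE w in lborel. w \<notin> (\<Union>n. S n))"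
    proof
      assume "AE w in lborel. w \<notin> (\<Union>n. S n)"
      hence "AE w in lborel. 0 < base \<beta> w"
      proof eventually_elim
        case (elim w)
        show ?case
        proof (rule ccontr)
          assume b: "\<not> 0 < base \<beta> w"
          hence "p0 w > 0"
            using base_pos_if_p0_zero[of w \<beta>] p0_nonneg[of w] by force
          hence "\<forall>\<^sub>F n in sequentially. w \<in> core (real (Suc n))"
            by (rule in_core_eventually)
          hence "\<forall>\<^sub>F n in sequentially. w \<in> S n"
            by eventually_elim (use b in \<open>auto simp: S_def\<close>)
          thus False using elim by (auto simp: eventually_sequentially)
        qed
      qed
      thus False using nonpos by simp
    qed
    show "bounded (S n)" for n
      by (rule bounded_subset[OF core_bounded[of "real (Suc n)"]]) (auto simp: S_def)
  qed simp
  then obtain n where n: "0 < measure lborel (S n)" by blast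
  have sub: "S n \<subseteq> core (real (Suc n))" by (auto simp: S_def)
  have "inner_lagrangian \<beta> (\<lambda>w. 1 / measure lborel (S n) * indicator (S n) w)
      \<le> (0 * measure lborel (S n) powr (1 - q) - 1) / (q - 1)"
    by (rule inner_lagrangian_uniform[OF S sub])
      (use n \<open>q > 1\<close> in \<open>auto simp: S_def mult_nonneg_nonpos\<close>)
  thus "\<exists>p. adm p \<and> inner_lagrangian \<beta> p \<le> - (1 / (q - 1))"
    using uniform_adm[OF S sub] n by (intro exI[of _ "\<lambda>w. 1 / measure lborel (S n) * indicator (S n) w"]) auto
qed

text \<open>Truncating the unnormalized minimizer gives admissible densities approaching the infimum.\<close>

lemma inner_lagrangian_approx:
  assumes pos: "AE w in lborel. 0 < base \<beta> w" and c: "- q_ln_ext q (Z \<beta>) < ereal c"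
  shows "\<exists>p. adm p \<and> inner_lagrangian \<beta> p < c"
proof -
  define S where "S n = {w \<in> core (real (Suc n)). 0 < base \<beta> w \<and> tilted \<beta> w \<le> real (Suc n)}" for n
  have S [measurable]: "S n \<in> sets borel" for n
    unfolding S_def by measurable
  have S_mono: "S m \<subseteq> S n" if "m \<le> n" for m n
    unfolding S_def using core_mono[of "real (Suc m)" "real (Suc n)"] that by auto
  define r where "r n w = tilted \<beta> w * indicator (S n) w" for n w
  have r: "r n \<in> borel_measurable borel" "0 \<le> r n w" "r n w \<le> real (Suc n)"
      "w \<notin> core (real (Suc n)) \<Longrightarrow> r n w = 0" for n w
    unfolding r_def using tilted_nonneg[of \<beta> w] by (auto simp: S_def indicator_def)
  have rint: "integrands_integrable (r n)" for n
    by (rule bounded_integrands_integrable[of _ "real (Suc n)" "real (Suc n)"]) (use r in simp_all)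
  define z where "z n = (LINT w|lborel. r n w)" for n
  have "(\<lambda>n. \<integral>\<^sup>+ w. ennreal (r n w) \<partial>lborel) \<longlonglongrightarrow> (\<integral>\<^sup>+ w. ennreal (tilted \<beta> w) * indicator {w. 0 < base \<beta> w} w \<partial>lborel)"
  proof (rule nn_integral_LIMSEQ)
    show "incseq (\<lambda>n w. ennreal (r n w))"
      using S_mono tilted_nonneg
      by (auto simp: incseq_def le_fun_def r_def indicator_def intro!: ennreal_leI)
    fix w
    show "(\<lambda>n. ennreal (r n w)) \<longlonglongrightarrow> ennreal (tilted \<beta> w) * indicator {w. 0 < base \<beta> w} w"
    proof (cases "p0 w > 0 \<and> 0 < base \<beta> w")
      case True
      obtain N where N: "tilted \<beta> w \<le> real N"
        using real_arch_simple by blast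
      have "\<forall>\<^sub>F n in sequentially. tilted \<beta> w \<le> real (Suc n)"
        using N by (auto simp: eventually_sequentially intro!: exI[of _ N])
      moreover have "\<forall>\<^sub>F n in sequentially. w \<in> core (real (Suc n))"
        using True by (intro in_core_eventually) auto
      ultimately have "\<forall>\<^sub>F n in sequentially. w \<in> S n"
        by eventually_elim (use True in \<open>simp add: S_def\<close>)
      hence "\<forall>\<^sub>F n in sequentially. ennreal (r n w) = ennreal (tilted \<beta> w) * indicator {w. 0 < base \<beta> w} w"
        by eventually_elim (use True in \<open>simp add: r_def\<close>)
      thus ?thesis by (rule tendsto_eventually)
    next
      case False
      hence "r n w = 0" "tilted \<beta> w * indicator {w. 0 < base \<beta> w} w = 0" for n
        using p0_nonneg[of w] by (auto simp: r_def S_def tilted_def indicator_def)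
      thus ?thesis by (auto simp: indicator_def)
    qed
  qed (use r(1) in measurable)
  also have "(\<integral>\<^sup>+ w. ennreal (tilted \<beta> w) * indicator {w. 0 < base \<beta> w} w \<partial>lborel) = Z \<beta>"
    unfolding normalizer_eq[OF pos] using pos by (intro nn_integral_cong_AE) (auto elim: eventually_mono)
  also have "(\<lambda>n. \<integral>\<^sup>+ w. ennreal (r n w) \<partial>lborel) = (\<lambda>n. ennreal (z n))"
    unfolding z_def using rint r(2) by (simp add: nn_integral_eq_integral integrands_integrable_def)
  finally have lim: "(\<lambda>n. ennreal (z n)) \<longlonglongrightarrow> Z \<beta>" .
  have z_nonneg: "z n \<ge> 0" for n
    unfolding z_def using r(2) by simp
  have truncated: "adm (\<lambda>w. 1 / z n * r n w)" "inner_lagrangian \<beta> (\<lambda>w. 1 / z n * r n w) = - q_ln q (z n)"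
    if zn: "z n > 0" for n
  proof -
    show adm: "adm (\<lambda>w. 1 / z n * r n w)"
      using normalized_adm(1)[OF rint zn z_def[symmetric]] .
    \<comment> \<open>On \<open>S n\<close> the density is \<open>tilted \<beta> w / z n\<close>, so
      the ratio inside the deformed logarithm is the constant \<open>z n\<close>; off
      \<open>S n\<close> both sides vanish.\<close>
    have "tsallis_integrand q (1 / z n * r n w) (p0 w) - linear_score \<beta> w * (1 / z n * r n w) powr q
        = - (1 / z n * r n w) * q_ln q (z n)" for w
    proof (cases "w \<in> S n")
      case True
      hence "1 / real (Suc n) \<le> p0 w" "0 < base \<beta> w"
        by (auto simp: S_def core_def)
      moreover hence p0: "p0 w > 0"
        by (meson divide_pos_pos less_le_trans zero_less_one of_nat_0_less_iff zero_less_Suc)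
      ultimately have "tsallis_integrand q (1 / z n * r n w) (p0 w) - linear_score \<beta> w * (1 / z n * r n w) powr q
          = tsallis_integrand q (1 / z n * r n w) (tilted \<beta> w)"
        using zn r(2)[of n w] by (intro inner_integrand_tilted) auto
      moreover have "tilted \<beta> w > 0"
        using p0 q_exp_expo_pos[OF \<open>0 < base \<beta> w\<close>] by (simp add: tilted_def)
      ultimately show ?thesis
        using True zn by (simp add: tsallis_integrand_def r_def)
    qed (simp add: r_def)
    hence "inner_lagrangian \<beta> (\<lambda>w. 1 / z n * r n w) = (LINT w|lborel. - (1 / z n * r n w) * q_ln q (z n))"
      by (simp only: inner_lagrangian_integral(2)[OF adm])
    also have "\<dots> = - q_ln q (z n)"
      using adm_props(3,4)[OF adm] by simp
    finally show "inner_lagrangian \<beta> (\<lambda>w. 1 / z n * r n w) = - q_ln q (z n)" .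
  qed
  have zpos: "\<forall>\<^sub>F n in sequentially. z n > 0"
    using order_tendstoD(1)[OF lim normalizer_pos] by simp
  have "\<forall>\<^sub>F n in sequentially. - c < q_ln q (z n)"
  proof (cases "Z \<beta> < \<infinity>")
    case True
    have "(\<lambda>n. enn2real (ennreal (z n))) \<longlonglongrightarrow> enn2real (Z \<beta>)"
      using True lim by (intro tendsto_enn2real) (auto simp: less_top)
    hence "z \<longlonglongrightarrow> enn2real (Z \<beta>)"
      using z_nonneg by simp
    hence "(\<lambda>n. q_ln q (z n)) \<longlonglongrightarrow> q_ln q (enn2real (Z \<beta>))"
      using tilted_integral(3)[OF True] by (intro tendsto_q_ln)
    moreover have "- c < q_ln q (enn2real (Z \<beta>))"
      using c True by (simp add: q_ln_ext_def)
    ultimately show ?thesis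
      by (rule order_tendstoD)
  next
    case False
    hence top: "Z \<beta> = \<infinity>" by (metis infinity_ennreal_def less_top)
    \<comment> \<open>The truncated masses diverge, and \<open>q_ln q (z n)\<close> tends to the
      value that \<open>q_ln_ext\<close> prescribes for an infinite normalizer.\<close>
    have z_top: "filterlim z at_top sequentially"
      using lim unfolding top by (simp add: ennreal_tendsto_top_eq_at_top)
    show ?thesis
    proof (cases "q = 1")
      case True
      have "filterlim (\<lambda>n. ln (z n)) at_top sequentially"
        by (rule filterlim_compose[OF ln_at_top z_top])
      thus ?thesis
        using True by (simp add: q_ln_def filterlim_at_top_dense)
    next
      case False
      hence "q > 1" using q by simp
      moreover hence "- c < 1 / (q - 1)"
        using c by (simp add: q_ln_ext_def top)
      ultimately show ?thesis
        using order_tendstoD(1)[OF q_ln_at_top_gt_one[OF _ z_top]] by simp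
    qed
  qed
  with zpos have "\<forall>\<^sub>F n in sequentially. z n > 0 \<and> - c < q_ln q (z n)"
    by (rule eventually_conj)
  then obtain n where "z n > 0" "- c < q_ln q (z n)"
    by (auto simp: eventually_sequentially)
  thus ?thesis
    using truncated[of n] by (intro exI[of _ "\<lambda>w. 1 / z n * r n w"]) auto
qed

lemma inner_lagrangian_lower:
  assumes base: "AE w in lborel. 0 \<le> base \<beta> w" and p: "adm p"
  shows "- q_ln_ext q (Z \<beta>) \<le> ereal (inner_lagrangian \<beta> p)"
proof (cases "Z \<beta> < \<infinity>")
  case True
  thus ?thesis
    using gibbs(1)[OF True p] by (simp add: q_ln_ext_def)
next
  case False
  show ?thesis
  proof (cases "q > 1")
    case True
    thus ?thesis
      using gibbs_infinite(1)[OF base p True] False by (simp add: q_ln_ext_def)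
  qed (use False in \<open>simp add: q_ln_ext_def\<close>)
qed

text \<open>If the base vanishes on a set of positive measure, the normalizer is infinite and
  concentration on that set replaces truncation.\<close>

lemma inner_lagrangian_upper:
  assumes base: "AE w in lborel. 0 \<le> base \<beta> w" and c: "- q_ln_ext q (Z \<beta>) < ereal c"
  shows "\<exists>p. adm p \<and> inner_lagrangian \<beta> p < c"
proof (cases "AE w in lborel. 0 < base \<beta> w")
  case False
  hence "\<not> Z \<beta> < \<infinity>"
    using AE_base_pos by blast
  hence "- (1 / (q - 1)) < c"
    using c inner_lagrangian_degenerate(1)[OF False] by (simp add: q_ln_ext_def)
  thus ?thesis
    using inner_lagrangian_degenerate(2)[OF False] by force
qed (use inner_lagrangian_approx c in blast)

section \<open>Minimization over the margins variable\<close>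

definition "outer_lagrangian \<beta> z = (\<Sum>i\<in>UNIV. C * q_exp q' (- z $ i) + \<beta> $ i * z $ i)"

lemma lagrangian_split: "L \<beta> p z = inner_lagrangian \<beta> p + outer_lagrangian \<beta> z"
  by (simp add: lagrangian_eq inner_lagrangian_def outer_lagrangian_def sum.distrib sum_distrib_left
      inner_diff_right inner_vec_def[of \<beta> z])

abbreviation "penalty \<beta> \<equiv> ereal C * gen_tsallis_div_ext (1 / ereal q') ((1 / C) *\<^sub>R \<beta>) (\<chi> i. 1)"

lemma outer_lagrangian_update:
  "outer_lagrangian \<beta> (\<chi> i. if i = j then t else 0)
    = (C * q_exp q' (- t) + \<beta> $ j * t) + (\<Sum>i\<in>UNIV - {j}. C * q_exp q' 0)"
  unfolding outer_lagrangian_def by (subst sum.remove[of _ j]) (auto intro!: sum.cong)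

lemma outer_lagrangian_unbounded_coordinate:
  assumes "\<And>c. \<exists>t. C * q_exp q' (- t) + \<beta> $ j * t < c"
  shows "\<exists>z. outer_lagrangian \<beta> z < c"
proof -
  obtain t where "C * q_exp q' (- t) + \<beta> $ j * t < c - (\<Sum>i\<in>UNIV - {j}. C * q_exp q' 0)"
    using assms by blast
  thus ?thesis
    using outer_lagrangian_update[of \<beta> j t] by (intro exI[of _ "\<chi> i. if i = j then t else 0"]) linarith
qed

lemma outer_lagrangian_scaled:
  "outer_lagrangian \<beta> z = C * (\<Sum>i\<in>UNIV. q_exp q' (- z $ i) + ((1 / C) *\<^sub>R \<beta>) $ i * z $ i)"
  using C by (simp add: outer_lagrangian_def sum_distrib_left distrib_left)

text \<open>The minimization decouples over the coordinates, with slopes \<open>\<beta> / C\<close>.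
  As the divergence sums \<open>1 - v i\<close>, the infimum is \<open>C * CARD('m)\<close> minus
  the penalty; this is the additive constant of the dual.\<close>

lemma outer_dual:
  fixes \<beta> z :: "real ^ 'm"
  assumes \<beta>: "\<And>i. 0 \<le> \<beta> $ i"
  shows "penalty \<beta> \<noteq> - \<infinity>"
    and "ereal (C * CARD('m)) - penalty \<beta> \<le> ereal (outer_lagrangian \<beta> z)"
    and "ereal (C * CARD('m)) - penalty \<beta> < ereal c \<Longrightarrow> \<exists>z. outer_lagrangian \<beta> z < c"
proof -
  define b where "b = (1 / C) *\<^sub>R \<beta>"
  have b: "0 \<le> b $ i" for i
    using \<beta> C by (simp add: b_def)
  have outer: "outer_lagrangian \<beta> z = C * (\<Sum>i\<in>UNIV. q_exp q' (- z $ i) + b $ i * z $ i)" for z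
    unfolding b_def by (rule outer_lagrangian_scaled)
  consider (finite) v where "\<And>i z. v i \<le> q_exp q' (- z) + b $ i * z"
      "\<And>i e. e > 0 \<Longrightarrow> \<exists>z. q_exp q' (- z) + b $ i * z < v i + e"
      "gen_tsallis_div_ext (1 / ereal q') b (\<chi> i. 1) = ereal (\<Sum>i\<in>UNIV. 1 - v i)"
    | (infinite) j where "gen_tsallis_div_ext (1 / ereal q') b (\<chi> i. 1) = \<infinity>"
      "\<And>c. \<exists>z. q_exp q' (- z) + b $ j * z < c"
    using gen_tsallis_div_conjugate[OF q' b] by blast
  hence "penalty \<beta> \<noteq> - \<infinity> \<and> ereal (C * CARD('m)) - penalty \<beta> \<le> ereal (outer_lagrangian \<beta> z) \<and>
    (ereal (C * CARD('m)) - penalty \<beta> < ereal c \<longrightarrow> (\<exists>z. outer_lagrangian \<beta> z < c))"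
  proof cases
    case finite
    have val: "ereal (C * CARD('m)) - penalty \<beta> = ereal (C * (\<Sum>i\<in>UNIV. v i))"
      unfolding b_def[symmetric] finite(3) by (simp add: sum_subtractf algebra_simps)
    have "C * (\<Sum>i\<in>UNIV. v i) \<le> outer_lagrangian \<beta> z"
      unfolding outer using C finite(1) by (intro mult_left_mono sum_mono) auto
    moreover have "\<exists>z. outer_lagrangian \<beta> z < c" if c: "C * (\<Sum>i\<in>UNIV. v i) < c"
    proof -
      \<comment> \<open>The available slack is shared equally among the coordinates.\<close>
      define e where "e = (c - C * (\<Sum>i\<in>UNIV. v i)) / (C * CARD('m))"
      have e: "e > 0" using c C by (simp add: e_def)
      have "\<forall>i. \<exists>t. q_exp q' (- t) + b $ i * t < v i + e"
        using finite(2)[OF e] by blast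
      then obtain t where t: "\<And>i. q_exp q' (- t i) + b $ i * t i < v i + e"
        by metis
      have "outer_lagrangian \<beta> (\<chi> i. t i) < C * (\<Sum>i\<in>UNIV. v i + e)"
        unfolding outer using C t by (intro mult_strict_left_mono sum_strict_mono) auto
      also have "\<dots> = C * (\<Sum>i\<in>UNIV. v i) + e * (C * CARD('m))"
        by (simp add: sum.distrib algebra_simps)
      also have "\<dots> = c"
        using C by (simp add: e_def)
      finally show ?thesis by blast
    qed
    ultimately show ?thesis
      unfolding val by (simp add: b_def[symmetric] finite(3))
  next
    case infinite
    have pen: "penalty \<beta> = \<infinity>"
      unfolding b_def[symmetric] infinite(1) using C by simp
    have "\<exists>z. outer_lagrangian \<beta> z < c"
    proof (rule outer_lagrangian_unbounded_coordinate)
      fix c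
      obtain t where "q_exp q' (- t) + b $ j * t < c / C"
        using infinite(2) by blast
      hence "C * (q_exp q' (- t) + b $ j * t) < c"
        using C by (simp add: pos_less_divide_eq mult.commute)
      thus "\<exists>t. C * q_exp q' (- t) + \<beta> $ j * t < c"
        using C by (intro exI[of _ t]) (simp add: b_def distrib_left)
    qed
    thus ?thesis
      unfolding pen by simp
  qed
  thus "penalty \<beta> \<noteq> - \<infinity>" "ereal (C * CARD('m)) - penalty \<beta> \<le> ereal (outer_lagrangian \<beta> z)"
    "ereal (C * CARD('m)) - penalty \<beta> < ereal c \<Longrightarrow> \<exists>z. outer_lagrangian \<beta> z < c"
    by auto
qed

section \<open>The Lagrange dual function\<close>

abbreviation "dual \<equiv> lagrange_dual_function q q' C p0 y f"

lemma dual_le: "adm p \<Longrightarrow> dual \<beta> \<le> ereal (L \<beta> p z)"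
  unfolding lagrange_dual_function_def by (rule INF_lower2[of "(p, z)"]) auto

text \<open>The Lagrangian is a function of \<open>p\<close> plus a function of \<open>z\<close>, so
  its infimum is a sum of infima. A negative multiplier makes the part in \<open>z\<close> unbounded
  below, a base that is negative on a non-null set the part in \<open>p\<close>.\<close>

lemma dual_eq:
  "dual \<beta> = (if \<forall>i. 0 \<le> \<beta> $ i then ereal (C * CARD('m)) - dual_objective q q' C p0 H \<beta> else - \<infinity>)"
proof -
  have unbounded: "dual \<beta> = - \<infinity>" if low: "\<And>c. \<exists>p z. adm p \<and> L \<beta> p z < c"
  proof (rule ereal_bot)
    fix c
    obtain p z where "adm p" "L \<beta> p z < c" using low by blast
    thus "dual \<beta> \<le> ereal c"
      using dual_le[of p \<beta> z] by (meson ereal_less_eq(3) less_imp_le order.trans)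
  qed
  show ?thesis
  proof (cases "\<forall>i. 0 \<le> \<beta> $ i")
    case False
    then obtain j where j: "\<beta> $ j < 0" by (auto simp: not_le)
    obtain p where p: "adm p" using exists_adm by blast
    have "\<exists>p z. adm p \<and> L \<beta> p z < c" for c
    proof -
      obtain z where "outer_lagrangian \<beta> z < c - inner_lagrangian \<beta> p"
        using outer_lagrangian_unbounded_coordinate[OF q_exp_linear_unbounded[OF q' C j]] by blast
      thus ?thesis using p by (auto simp: lagrangian_split intro!: exI[of _ p] exI[of _ z])
    qed
    thus ?thesis using unbounded False by auto
  next
    case \<beta>: True
    show ?thesis
    proof (cases "AE w in lborel. 0 \<le> base \<beta> w")
      case False
      have "\<exists>p z. adm p \<and> L \<beta> p z < c" for c
      proof -
        obtain p where "adm p" "inner_lagrangian \<beta> p < c - outer_lagrangian \<beta> 0"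
          using inner_lagrangian_unbounded[OF False] by blast
        thus ?thesis by (intro exI[of _ p] exI[of _ 0]) (simp add: lagrangian_split)
      qed
      moreover have "dual_objective q q' C p0 H \<beta> = \<infinity>"
        using False by (simp add: dual_objective_def base_def)
      ultimately show ?thesis using unbounded \<beta> by simp
    next
      case base: True
      define Q where "Q = q_ln_ext q (Z \<beta>)"
      note outer = outer_dual[of \<beta>]
      have Q: "Q \<noteq> - \<infinity>"
        by (simp add: Q_def q_ln_ext_def)
      have obj: "dual_objective q q' C p0 H \<beta> = Q + penalty \<beta>"
        using base by (simp add: dual_objective_def base_def Q_def)
      \<comment> \<open>The rearrangement is safe in extended arithmetic because neither
        \<open>Q\<close> nor the penalty is minus infinity.\<close>
      have split: "ereal (C * CARD('m)) - (Q + penalty \<beta>) = - Q + (ereal (C * CARD('m)) - penalty \<beta>)"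
        using Q outer(1) \<beta> by (cases Q; cases "penalty \<beta>") auto
      have "dual \<beta> = - Q + (ereal (C * CARD('m)) - penalty \<beta>)"
      proof (rule antisym)
        show "- Q + (ereal (C * CARD('m)) - penalty \<beta>) \<le> dual \<beta>"
          unfolding lagrange_dual_function_def
        proof (rule INF_greatest, clarsimp)
          fix p z assume p: "adm p"
          have "- Q + (ereal (C * CARD('m)) - penalty \<beta>) \<le> ereal (inner_lagrangian \<beta> p) + ereal (outer_lagrangian \<beta> z)"
            unfolding Q_def by (rule add_mono[OF inner_lagrangian_lower[OF base p] outer(2)]) (use \<beta> in blast)
          thus "- Q + (ereal (C * CARD('m)) - penalty \<beta>) \<le> ereal (L \<beta> p z)"
            by (simp add: lagrangian_split)
        qed
        \<comment> \<open>The infima need not be attained, so near-optimal \<open>p\<close> and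
          \<open>z\<close> are combined below an arbitrary larger \<open>x\<close>.\<close>
        show "dual \<beta> \<le> - Q + (ereal (C * CARD('m)) - penalty \<beta>)"
        proof (rule dense_ge)
          fix x assume x: "- Q + (ereal (C * CARD('m)) - penalty \<beta>) < x"
          show "dual \<beta> \<le> x"
          proof (cases x)
            case (real c)
            have "- Q \<noteq> \<infinity>"
              using Q by (cases Q) auto
            moreover have "ereal (C * CARD('m)) - penalty \<beta> \<noteq> \<infinity>"
              using outer(1) \<beta> by (cases "penalty \<beta>") auto
            ultimately obtain c1 c2 where c: "- Q < ereal c1" "ereal (C * CARD('m)) - penalty \<beta> < ereal c2" "c1 + c2 \<le> c"
              using ereal_add_less_real_split[OF _ _ x[unfolded real]] by blast
            obtain p where p: "adm p" "inner_lagrangian \<beta> p < c1"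
              using inner_lagrangian_upper[OF base] c(1) by (auto simp: Q_def)
            obtain z where "outer_lagrangian \<beta> z < c2"
              using outer(3) c(2) \<beta> by blast
            hence "ereal (L \<beta> p z) \<le> x"
              using p c(3) real by (simp add: lagrangian_split)
            thus ?thesis
              using dual_le[OF p(1), of \<beta> z] by (rule order.trans[rotated])
          qed (use x in auto)
        qed
      qed
      thus ?thesis
        using \<beta> by (simp add: obj split)
    qed
  qed
qed

section \<open>Strong duality and recovery of the solution\<close>

lemma feasible_iff: "primal_feasible q p0 y f p z \<longleftrightarrow> adm p \<and> z = margins p"
  by (auto simp: primal_feasible_def margins_def vec_eq_iff)

abbreviation "objective p \<equiv> primal_objective q q' C p0 p (margins p)"

lemma lagrangian_margins: "L \<beta> p (margins p) = objective p"
  by (simp add: lagrangian_eq primal_objective_def)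

text \<open>The Gibbs bound at \<open>\<beta> = 0\<close>, where the tilted prior is the prior
  itself and has mass 1.\<close>

lemma divergence_nonneg:
  assumes p: "adm p"
  shows "0 \<le> tsallis_div q p p0"
proof -
  have expo: "expo 0 w = 0" for w
    by (simp add: expo_eq linear_score_def)
  hence base: "base 0 w = 1" for w
    by (simp add: base_def)
  have "Z 0 = (\<integral>\<^sup>+ w. ennreal (p0 w) \<partial>lborel)"
    by (subst normalizer_eq) (simp_all add: base tilted_def expo q_exp_def)
  also have "\<dots> = 1"
    using p0_nonneg p0_integrable p0_integral by (simp add: nn_integral_eq_integral)
  finally have "Z 0 = 1" .
  thus ?thesis
    using gibbs(1)[OF _ p, of 0] by (simp add: inner_lagrangian_def)
qed

lemma objective_nonneg: "adm p \<Longrightarrow> 0 \<le> objective p"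
  unfolding primal_objective_def using C
  by (intro add_nonneg_nonneg divergence_nonneg mult_nonneg_nonneg sum_nonneg q_exp_nonneg) auto

abbreviation "pvalue \<equiv> primal_value q q' C p0 y f"

lemma pvalue_le: "adm p \<Longrightarrow> pvalue \<le> ereal (objective p)"
  unfolding primal_value_def by (rule INF_lower2[of "(p, margins p)"]) (auto simp: feasible_iff)

lemma weak_duality: "dual \<beta> \<le> pvalue"
  unfolding primal_value_def
proof (rule INF_greatest, clarsimp simp: feasible_iff)
  fix p assume "adm p"
  thus "dual \<beta> \<le> ereal (objective p)"
    using dual_le[of p \<beta> "margins p"] by (simp add: lagrangian_margins)
qed

text \<open>The value is finite, since divergence and loss are nonnegative and an admissible density
  exists. The multiplier for the level \<open>\<alpha>\<close> equal to this value closes the gap,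
  whether or not the primal infimum is attained.\<close>

lemma strong_duality: "\<exists>\<beta>. dual \<beta> = pvalue \<and> (\<exists>\<alpha>. pvalue = ereal \<alpha>)"
proof -
  have "0 \<le> pvalue"
    unfolding primal_value_def
    by (rule INF_greatest) (auto simp: feasible_iff objective_nonneg)
  moreover obtain p where "adm p" using exists_adm by blast
  ultimately obtain \<alpha> where \<alpha>: "pvalue = ereal \<alpha>"
    using pvalue_le[of p] by (cases pvalue) auto
  have "\<alpha> \<le> objective p" if "adm p" for p
    using pvalue_le[OF that] by (simp add: \<alpha>)
  then obtain \<beta> where "\<forall>p z. adm p \<longrightarrow> \<alpha> \<le> L \<beta> p z"
    using exists_multiplier by blast
  hence "pvalue \<le> dual \<beta>"
    unfolding \<alpha> lagrange_dual_function_def by (auto intro!: INF_greatest)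
  thus ?thesis
    using weak_duality[of \<beta>] \<alpha> by (intro exI[of _ \<beta>]) auto
qed

text \<open>On the nonnegative orthant the dual objective is a constant minus \<open>dual\<close>,
  so strong duality identifies its minimum as \<open>C * CARD('m) - \<alpha>\<close>; finiteness of
  the value permits solving for either side.\<close>

lemma dual_solution_iff: "dual_solution q q' C p0 H \<beta> \<longleftrightarrow> dual \<beta> = pvalue"
proof -
  obtain \<beta>' \<alpha> where opt: "dual \<beta>' = pvalue" "pvalue = ereal \<alpha>"
    using strong_duality by blast
  let ?D = "dual_objective q q' C p0 H"
  have nonneg: "\<forall>i. 0 \<le> \<gamma> $ i" "?D \<gamma> = ereal (C * CARD('m)) - ereal \<alpha>" if "dual \<gamma> = pvalue" for \<gamma>
  proof -
    show "\<forall>i. 0 \<le> \<gamma> $ i"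
      using that opt(2) dual_eq[of \<gamma>] by (auto split: if_splits)
    thus "?D \<gamma> = ereal (C * CARD('m)) - ereal \<alpha>"
      using that opt(2) dual_eq[of \<gamma>] by (cases "?D \<gamma>") auto
  qed
  have lower: "ereal (C * CARD('m)) - ereal \<alpha> \<le> ?D \<gamma>" if "\<forall>i. 0 \<le> \<gamma> $ i" for \<gamma>
    using weak_duality[of \<gamma>] dual_eq[of \<gamma>] that opt(2) by (cases "?D \<gamma>") auto
  show ?thesis
  proof
    assume "dual \<beta> = pvalue"
    thus "dual_solution q q' C p0 H \<beta>"
      unfolding dual_solution_def using nonneg[of \<beta>] lower by auto
  next
    assume sol: "dual_solution q q' C p0 H \<beta>"
    hence "?D \<beta> \<le> ereal (C * CARD('m)) - ereal \<alpha>" "\<forall>i. 0 \<le> \<beta> $ i"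
      using nonneg[OF opt(1)] by (auto simp: dual_solution_def)
    hence "?D \<beta> = ereal (C * CARD('m)) - ereal \<alpha>"
      using lower[of \<beta>] by (intro antisym) auto
    thus "dual \<beta> = pvalue"
      using dual_eq[of \<beta>] \<open>\<forall>i. 0 \<le> \<beta> $ i\<close> opt(2) by auto
  qed
qed

lemma solution_value:
  assumes "primal_solution q q' C p0 y f p z"
  shows "adm p" "z = margins p" "pvalue = ereal (objective p)"
proof -
  show p: "adm p" "z = margins p"
    using assms by (auto simp: primal_solution_def feasible_iff)
  show "pvalue = ereal (objective p)"
  proof (rule antisym)
    show "ereal (objective p) \<le> pvalue"
      unfolding primal_value_def
      by (rule INF_greatest) (use assms p in \<open>auto simp: primal_solution_def feasible_iff\<close>)
  qed (rule pvalue_le[OF p(1)])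
qed

text \<open>At a primal solution the constraint terms vanish, so the Lagrangian there equals the
  primal value for every \<open>\<beta>\<close>; its minimality says that the dual function reaches
  this value.\<close>

lemma multiplier_iff:
  assumes "primal_solution q q' C p0 y f p z"
  shows "lagrange_multiplier q q' C p0 y f p z \<beta> \<longleftrightarrow> dual \<beta> = pvalue"
proof -
  note sol = solution_value[OF assms]
  have "lagrange_multiplier q q' C p0 y f p z \<beta> \<longleftrightarrow> pvalue \<le> dual \<beta>"
    unfolding lagrange_multiplier_def sol(2,3) lagrangian_margins lagrange_dual_function_def
    by (auto simp: le_INF_iff)
  thus ?thesis
    using weak_duality[of \<beta>] by auto
qed

text \<open>Varying \<open>p\<close> alone at fixed \<open>z\<close> shows that \<open>p\<close>
  attains the infimum \<open>- q_ln_ext q (Z \<beta>)\<close>. An infinite normalizer is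
  incompatible with attainment; for a finite one the equality case of \<open>gibbs\<close>
  determines \<open>p\<close>.\<close>

lemma solution_density:
  assumes sol: "primal_solution q q' C p0 y f p z"
    and mult: "lagrange_multiplier q q' C p0 y f p z \<beta>"
    and ext: "AE w in lborel. q_exp_ext q (expo \<beta> w) < \<infinity>"
  shows "Z \<beta> < \<infinity>"
    and "AE w in lborel. ennreal (p w) = 1 / Z \<beta> * ennreal (p0 w) * q_exp_ext q (expo \<beta> w)"
proof -
  note s = solution_value[OF sol]
  have pos: "AE w in lborel. 0 < base \<beta> w"
    using ext unfolding base_pos_iff .
  hence nonneg: "AE w in lborel. 0 \<le> base \<beta> w"
    by (auto elim: eventually_mono)
  have min: "inner_lagrangian \<beta> p \<le> inner_lagrangian \<beta> p'" if "adm p'" for p'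
  proof -
    have "L \<beta> p z \<le> L \<beta> p' z"
      using mult that by (simp add: lagrange_multiplier_def)
    thus ?thesis by (simp add: lagrangian_split)
  qed
  have "ereal (inner_lagrangian \<beta> p) \<le> - q_ln_ext q (Z \<beta>)"
  proof (rule dense_ge)
    fix x assume x: "- q_ln_ext q (Z \<beta>) < x"
    show "ereal (inner_lagrangian \<beta> p) \<le> x"
    proof (cases x)
      case (real c)
      thus ?thesis
        using inner_lagrangian_approx[OF pos, of c] x min by force
    qed (use x in auto)
  qed
  hence eq: "ereal (inner_lagrangian \<beta> p) = - q_ln_ext q (Z \<beta>)"
    using inner_lagrangian_lower[OF nonneg s(1)] by (rule antisym)
  show fin: "Z \<beta> < \<infinity>"
  proof (rule ccontr)
    assume inf: "\<not> Z \<beta> < \<infinity>"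
    \<comment> \<open>For \<open>q = 1\<close> the right side of \<open>eq\<close> would be minus
      infinity, but the left side is real.\<close>
    hence "q > 1" "inner_lagrangian \<beta> p = - (1 / (q - 1))"
      using eq by (auto simp: q_ln_ext_def split: if_splits)
    thus False
      using gibbs_infinite(2)[OF nonneg s(1) _ pos] by simp
  qed
  have Z: "Z \<beta> = ennreal (enn2real (Z \<beta>))" "enn2real (Z \<beta>) > 0"
    using fin tilted_integral(3)[OF fin] by (auto simp: less_top)
  have "inner_lagrangian \<beta> p = - q_ln q (enn2real (Z \<beta>))"
    using eq fin by (simp add: q_ln_ext_def)
  from gibbs(2)[OF fin s(1) this] pos
  show "AE w in lborel. ennreal (p w) = 1 / Z \<beta> * ennreal (p0 w) * q_exp_ext q (expo \<beta> w)"
  proof eventually_elim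
    case (elim w)
    have "1 / Z \<beta> * ennreal (p0 w) * q_exp_ext q (expo \<beta> w) = 1 / ennreal (enn2real (Z \<beta>)) * ennreal (tilted \<beta> w)"
      using normalizer_integrand[OF elim(2)] Z(1) by (simp add: mult.assoc)
    also have "\<dots> = ennreal (1 / enn2real (Z \<beta>)) * ennreal (tilted \<beta> w)"
      using Z(2) by (simp add: divide_ennreal flip: ennreal_1)
    also have "\<dots> = ennreal (tilted \<beta> w / enn2real (Z \<beta>))"
      using Z(2) tilted_nonneg by (simp add: ennreal_mult'[symmetric])
    finally show ?case
      using elim(1) by simp
  qed
qed

end

theorem theorem2:
  fixes \<phi> :: "'d::finite \<Rightarrow> real ^ 'n::finite \<Rightarrow> real"
    and x :: "'m::finite \<Rightarrow> real ^ 'n"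
    and y :: "'m \<Rightarrow> real"
    and f :: "'m \<Rightarrow> real ^ 'd"
    and H :: "real ^ 'd ^ 'm"
    and p0 :: "real ^ 'd \<Rightarrow> real"
    and q q' C :: real
  assumes q: "q \<ge> 1" and q': "0 \<le> q'" "q' \<le> 1" and C: "C > 0"
    and labels: "\<And>i. y i \<in> {-1, 1}"
    and features: "\<And>i. f i = feature_vec \<phi> (x i)"
    and H: "H = label_feature_matrix y f"
    and prior: "prob_density p0"
  shows
    \<comment> \<open>every solution has multipliers, and these give its density\<close>
    "(\<forall>p z. primal_solution q q' C p0 y f p z \<longrightarrow>
        (\<exists>\<beta>. lagrange_multiplier q q' C p0 y f p z \<beta>) \<and>
        (\<forall>\<beta>. lagrange_multiplier q q' C p0 y f p z \<beta> \<and>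
             (AE w in lborel. q_exp_ext q (q_exponent q p0 H \<beta> w) < \<infinity>) \<longrightarrow>
           0 < q_normalizer q p0 H \<beta> \<and> q_normalizer q p0 H \<beta> < \<infinity> \<and>
           (AE w in lborel. ennreal (p w) =
              1 / q_normalizer q p0 H \<beta> * ennreal (p0 w)
                * q_exp_ext q (q_exponent q p0 H \<beta> w)))) \<and>
     \<comment> \<open>the Lagrange dual, up to sign and an additive constant\<close>
     (\<exists>K::real. \<forall>\<beta>. lagrange_dual_function q q' C p0 y f \<beta> =
        (if \<forall>i. 0 \<le> \<beta> $ i then ereal K - dual_objective q q' C p0 H \<beta> else - \<infinity>)) \<and>
     \<comment> \<open>solving the primal problem through the dual\<close>
     (\<exists>\<beta>. dual_solution q q' C p0 H \<beta> \<and>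
        primal_value q q' C p0 y f = lagrange_dual_function q q' C p0 y f \<beta>) \<and>
     (\<forall>p z \<beta>. primal_solution q q' C p0 y f p z \<longrightarrow>
        (lagrange_multiplier q q' C p0 y f p z \<beta> \<longleftrightarrow> dual_solution q q' C p0 H \<beta>))"
proof -
  interpret tsallis_problem q q' C p0 y f
    using q q' C prior by unfold_locales
  show ?thesis
    unfolding H
  proof (intro conjI allI impI)
    show "\<exists>K::real. \<forall>\<beta>. lagrange_dual_function q q' C p0 y f \<beta> =
        (if \<forall>i. 0 \<le> \<beta> $ i then ereal K - dual_objective q q' C p0 (label_feature_matrix y f) \<beta> else - \<infinity>)"
      using dual_eq by blast
    show "\<exists>\<beta>. dual_solution q q' C p0 (label_feature_matrix y f) \<beta> \<and>
        primal_value q q' C p0 y f = lagrange_dual_function q q' C p0 y f \<beta>"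
      using strong_duality dual_solution_iff by metis
    fix p z
    assume sol: "primal_solution q q' C p0 y f p z"
    show "\<exists>\<beta>. lagrange_multiplier q q' C p0 y f p z \<beta>"
      using strong_duality multiplier_iff[OF sol] by blast
    show "lagrange_multiplier q q' C p0 y f p z \<beta> \<longleftrightarrow> dual_solution q q' C p0 (label_feature_matrix y f) \<beta>" for \<beta>
      using multiplier_iff[OF sol] dual_solution_iff by simp
    fix \<beta>
    assume "lagrange_multiplier q q' C p0 y f p z \<beta> \<and>
      (AE w in lborel. q_exp_ext q (q_exponent q p0 (label_feature_matrix y f) \<beta> w) < \<infinity>)"
    hence mult: "lagrange_multiplier q q' C p0 y f p z \<beta>"
      and ext: "AE w in lborel. q_exp_ext q (q_exponent q p0 (label_feature_matrix y f) \<beta> w) < \<infinity>"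
      by auto
    show "0 < q_normalizer q p0 (label_feature_matrix y f) \<beta>"
      by (rule normalizer_pos)
    show "q_normalizer q p0 (label_feature_matrix y f) \<beta> < \<infinity>"
      by (rule solution_density(1)[OF sol mult ext])
    show "AE w in lborel. ennreal (p w) = 1 / q_normalizer q p0 (label_feature_matrix y f) \<beta> *
        ennreal (p0 w) * q_exp_ext q (q_exponent q p0 (label_feature_matrix y f) \<beta> w)"
      by (rule solution_density(2)[OF sol mult ext])
  qed
qed

end
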